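(* The ring $D_q$ of $q$-differential operators on $R=\Bbbk[x_1,\dots,x_n]$ is generated as a $\Bbbk$-algebra by $R$ (acting by multiplication) and the set $\{\partial_i^{\beta^{-1}},\partial_i,\partial_i^{\beta}\}_{1\le i\le n}$.
   Context: Let $q_1,\dots,q_n$ be transcendental elements over $\mathbb{Q}$ and let $\Bbbk$ be a field containing $\mathbb{Q}(q_1,\dots,q_n)$. Let $R=\Bbbk[x_1,\dots,x_n]$ be $\mathbb{Z}^n$-graded by $\deg(x_1^{a_1}\cdots x_n^{a_n})=(a_1,\dots,a_n)$, and let $\beta:\mathbb{Z}^n\times\mathbb{Z}^n\to\Bbbk^\times$ be the bicharacter $\beta(\mathbf a,\mathbf b)=q_1^{a_1b_1}\cdots q_n^{a_nb_n}$. A $\Bbbk$-linear endomorphism $\varphi$ of $R$ is homogeneous of degree $\mathbf d\in\mathbb{Z}^n$ if $\varphi(R_{\mathbf b})\subseteq R_{\mathbf b+\mathbf d}$ for all $\mathbf b\in\mathbb Z^n$; $\mathrm{grHom}_\Bbbk(R,R)$ is the space of finite sums of homogeneous endomorphisms. Each $r\in R$ is identified with the operator of multiplication by $r$; $\mathrm{grHom}_\Bbbk(R,R)$ is an $R$-bimodule via composition. For $\mathbf a\in\mathbb{Z}^n$ put $\widetilde\sigma_{\mathbf a}(\psi)=\beta(\mathbf a,\mathbf d)\psi$ for $\psi$ homogeneous of degree $\mathbf d$ (extended linearly), and $[\varphi,\psi]_{\mathbf a}=\varphi\psi-\widetilde\sigma_{\mathbf a}(\psi)\varphi$. $D_q^0$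 is the smallest $R$-sub-bimodule of $\mathrm{grHom}_\Bbbk(R,R)$ containing all homogeneous $\varphi$ for which there is $\mathbf a\in\mathbb{Z}^n$ with $[\varphi,r]_{\mathbf a}=0$ for all $r\in R$. Inductively, $D_q^{m+1}$ is the smallest $R$-sub-bimodule containing all homogeneous $\varphi$ for which there is $\mathbf a\in\mathbb{Z}^n$ with $[\varphi,r]_{\mathbf a}\in D_q^m$ for all $r\in R$. Put $D_q=\bigcup_{m\ge0}D_q^m$, a ring under composition. For $\mathbf a=(a_1,\dots,a_n)$ write $\mathbf x^{\mathbf a}=x_1^{a_1}\cdots x_n^{a_n}$, and let $\mathbf e_i$ be the $i$-th standard basis vector. $\partial_i=\partial/\partial x_i$ is the usual partial derivative, $\partial_i^{\beta}=\partial_i^{\beta^{1}}$, and for $k=\pm1$ the operator $\partial_i^{\beta^k}$ is the $\Bbbk$-linear operator with $\partial_i^{\beta^k}(\mathbf x^{\mathbf a})=\frac{q_i^{ka_i}-1}{q_i-1}\,\mathbf x^{\mathbf a-\mathbf e_i}$ (which is $0$ when $a_i=0$). *)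

theory Defs
  imports
    "HOL-Library.Poly_Mapping"
    "HOL-Computational_Algebra.Polynomial"
begin

section \<open>The graded polynomial ring\<close>

text \<open>
  Variables are indexed by a finite type \<open>'n\<close>; the type below is the monoid algebra of the
  additive monoid of exponent vectors \<open>'n \<Rightarrow>\<^sub>0 nat\<close>, i.e. the polynomial ring over \<open>'k\<close>,
  with its ring structure taken from \<^theory>\<open>HOL-Library.Poly_Mapping\<close>.
\<close>

type_synonym 'n expo = "'n \<Rightarrow>\<^sub>0 nat"
type_synonym ('n, 'k) mpoly = "'n expo \<Rightarrow>\<^sub>0 'k"
type_synonym ('n, 'k) oper = "('n, 'k) mpoly \<Rightarrow> ('n, 'k) mpoly"

definition pscale :: "'k::field \<Rightarrow> ('n, 'k) mpoly \<Rightarrow> ('n, 'k) mpoly"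
  where "pscale c p = Poly_Mapping.single 0 c * p"

definition monom_deg :: "'n expo \<Rightarrow> 'n \<Rightarrow> int"
  where "monom_deg m = (\<lambda>i. int (Poly_Mapping.lookup m i))"

text \<open>The component of degree \<open>b\<close>; it is zero if some entry of \<open>b\<close> is negative.\<close>

definition graded_part :: "('n \<Rightarrow> int) \<Rightarrow> ('n, 'k::field) mpoly set"
  where "graded_part b = {p. \<forall>m\<in>Poly_Mapping.keys p. monom_deg m = b}"

definition proj :: "('n \<Rightarrow> int) \<Rightarrow> ('n, 'k::field) oper"
  where "proj b p = (\<Sum>m\<in>{m \<in> Poly_Mapping.keys p. monom_deg m = b}.
                       Poly_Mapping.single m (Poly_Mapping.lookup p m))"

text \<open>The linear operator with prescribed values on the monomials.\<close>

definition lin_ext :: "('n expo \<Rightarrow> ('n, 'k::field) mpoly) \<Rightarrow> ('n, 'k) oper"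
  where "lin_ext f p = (\<Sum>m\<in>Poly_Mapping.keys p. pscale (Poly_Mapping.lookup p m) (f m))"


section \<open>Graded endomorphisms\<close>

definition endos :: "('n, 'k::field) oper set"
  where "endos = {\<phi>. Vector_Spaces.linear pscale pscale \<phi>}"

definition homogeneous :: "('n \<Rightarrow> int) \<Rightarrow> ('n, 'k::field) oper \<Rightarrow> bool"
  where "homogeneous d \<phi> \<longleftrightarrow>
    \<phi> \<in> endos \<and> (\<forall>b. \<phi> ` graded_part b \<subseteq> graded_part (\<lambda>i. b i + d i))"

definition grHom :: "('n, 'k::field) oper set"
  where "grHom = {\<phi>. \<exists>D \<psi>. finite D \<and> (\<forall>d\<in>D. homogeneous d (\<psi> d)) \<and>
                          \<phi> = (\<lambda>p. \<Sum>d\<in>D. \<psi> d p)}"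

text \<open>The homogeneous component of degree \<open>d\<close> of an operator.\<close>

definition oper_comp :: "('n \<Rightarrow> int) \<Rightarrow> ('n, 'k::field) oper \<Rightarrow> ('n, 'k) oper"
  where "oper_comp d \<phi> =
    lin_ext (\<lambda>m. proj (\<lambda>i. monom_deg m i + d i) (\<phi> (Poly_Mapping.single m 1)))"


section \<open>Twisted commutators and quantum differential operators\<close>

definition bichar :: "('n::finite \<Rightarrow> 'k::field) \<Rightarrow> ('n \<Rightarrow> int) \<Rightarrow> ('n \<Rightarrow> int) \<Rightarrow> 'k"
  where "bichar q a b = (\<Prod>i\<in>UNIV. q i powi (a i * b i))"

text \<open>
  Multiply the component of degree \<open>d\<close> by \<open>bichar q a d\<close>. The sum is finite for
  operators in \<^const>\<open>grHom\<close>; lemma \<open>twist_sum_homogeneous\<close> below shows that this is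
  the linear extension of the rule for homogeneous operators.
\<close>

definition twist :: "('n::finite \<Rightarrow> 'k::field) \<Rightarrow> ('n \<Rightarrow> int) \<Rightarrow> ('n, 'k) oper \<Rightarrow> ('n, 'k) oper"
  where "twist q a \<phi> = (\<lambda>p. \<Sum>d\<in>{d. oper_comp d \<phi> \<noteq> (\<lambda>_. 0)}. pscale (bichar q a d) (oper_comp d \<phi> p))"

definition bracket ::
    "('n::finite \<Rightarrow> 'k::field) \<Rightarrow> ('n \<Rightarrow> int) \<Rightarrow> ('n, 'k) oper \<Rightarrow> ('n, 'k) oper \<Rightarrow> ('n, 'k) oper"
  where "bracket q a \<phi> \<psi> = (\<lambda>p. \<phi> (\<psi> p) - twist q a \<psi> (\<phi> p))"

definition mult_oper :: "('n, 'k::field) mpoly \<Rightarrow> ('n, 'k) oper"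
  where "mult_oper r = (\<lambda>p. r * p)"

text \<open>Closure under negation and scalars follows by multiplying with constants.\<close>

definition sub_bimodule :: "('n, 'k::field) oper set \<Rightarrow> bool"
  where "sub_bimodule B \<longleftrightarrow> B \<subseteq> grHom \<and> (\<lambda>_. 0) \<in> B \<and>
    (\<forall>\<phi>\<in>B. \<forall>\<psi>\<in>B. (\<lambda>p. \<phi> p + \<psi> p) \<in> B) \<and>
    (\<forall>r. \<forall>\<phi>\<in>B. mult_oper r \<circ> \<phi> \<in> B \<and> \<phi> \<circ> mult_oper r \<in> B)"

primrec Dq_filt :: "('n::finite \<Rightarrow> 'k::field) \<Rightarrow> nat \<Rightarrow> ('n, 'k) oper set"
  where
    "Dq_filt q 0 = sub_bimodule hull
       {\<phi>. (\<exists>d. homogeneous d \<phi>) \<and> (\<exists>a. \<forall>r. bracket q a \<phi> (mult_oper r) = (\<lambda>_. 0))}"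
  | "Dq_filt q (Suc m) = sub_bimodule hull
       {\<phi>. (\<exists>d. homogeneous d \<phi>) \<and> (\<exists>a. \<forall>r. bracket q a \<phi> (mult_oper r) \<in> Dq_filt q m)}"

definition Dq :: "('n::finite \<Rightarrow> 'k::field) \<Rightarrow> ('n, 'k) oper set"
  where "Dq q = (\<Union>m. Dq_filt q m)"


section \<open>Generators\<close>

text \<open>
  Subtraction of exponents is truncated; where it truncates, the coefficient in the two
  definitions below is zero.
\<close>

definition partial :: "'n \<Rightarrow> ('n, 'k::field) oper"
  where "partial i = lin_ext (\<lambda>m.
    Poly_Mapping.single (m - Poly_Mapping.single i 1) (of_nat (Poly_Mapping.lookup m i)))"

definition q_partial :: "('n \<Rightarrow> 'k::field) \<Rightarrow> int \<Rightarrow> 'n \<Rightarrow> ('n, 'k) oper"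
  where "q_partial q k i = lin_ext (\<lambda>m.
    Poly_Mapping.single (m - Poly_Mapping.single i 1)
      ((q i powi (k * int (Poly_Mapping.lookup m i)) - 1) / (q i - 1)))"

definition subalgebra :: "('n, 'k::field) oper set \<Rightarrow> bool"
  where "subalgebra A \<longleftrightarrow> A \<subseteq> endos \<and> id \<in> A \<and>
    (\<forall>\<phi>\<in>A. \<forall>\<psi>\<in>A. (\<lambda>p. \<phi> p + \<psi> p) \<in> A \<and> \<phi> \<circ> \<psi> \<in> A) \<and>
    (\<forall>c. \<forall>\<phi>\<in>A. (\<lambda>p. pscale c (\<phi> p)) \<in> A)"


section \<open>Sanity checks\<close>

lemma lookup_pscale [simp]: "Poly_Mapping.lookup (pscale c p) m = c * Poly_Mapping.lookup p m"
  by (simp add: pscale_def mult_map_scale_conv_mult[symmetric] Poly_Mapping.map.rep_eq when_def)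

lemma vector_space_pscale: "vector_space (pscale :: 'k::field \<Rightarrow> ('n, 'k) mpoly \<Rightarrow> _)"
  by unfold_locales (auto intro!: poly_mapping_eqI simp: lookup_add algebra_simps)

lemma endos_iff:
  "\<phi> \<in> endos \<longleftrightarrow> (\<forall>p r. \<phi> (p + r) = \<phi> p + \<phi> r) \<and> (\<forall>c p. \<phi> (pscale c p) = pscale c (\<phi> p))"
  by (auto simp: endos_def Vector_Spaces.linear_iff vector_space_pscale)

lemma pscale_0 [simp]: "pscale c 0 = 0" "pscale 0 p = 0"
  by (auto intro!: poly_mapping_eqI)

lemma pscale_add: "pscale c (p + r) = pscale c p + pscale c r"
  by (auto intro!: poly_mapping_eqI simp: lookup_add algebra_simps)

lemma pscale_sum: "pscale c (sum f A) = (\<Sum>x\<in>A. pscale c (f x))"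
  by (auto intro!: poly_mapping_eqI simp: lookup_sum sum_distrib_left)

lemma endos_0: "\<phi> \<in> endos \<Longrightarrow> \<phi> 0 = 0"
  by (metis endos_iff add_cancel_right_right)

lemma endos_sum:
  assumes "\<phi> \<in> endos" shows "\<phi> (sum f A) = (\<Sum>x\<in>A. \<phi> (f x))"
  using assms by (induction A rule: infinite_finite_induct) (auto simp: endos_0 endos_iff)

lemma sum_monoms:
  "(\<Sum>m\<in>Poly_Mapping.keys p. pscale (Poly_Mapping.lookup p m) (Poly_Mapping.single m 1)) = p"
  by (auto intro!: poly_mapping_eqI
      simp: lookup_sum lookup_single when_def in_keys_iff sum.delta if_distrib cong: if_cong)

lemma lin_ext_endo:
  assumes "\<phi> \<in> endos" shows "lin_ext (\<lambda>m. \<phi> (Poly_Mapping.single m 1)) = \<phi>"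
proof
  fix p
  have "\<phi> p = \<phi> (\<Sum>m\<in>Poly_Mapping.keys p. pscale (Poly_Mapping.lookup p m) (Poly_Mapping.single m 1))"
    by (simp only: sum_monoms)
  also have "\<dots> = lin_ext (\<lambda>m. \<phi> (Poly_Mapping.single m 1)) p"
    unfolding endos_sum[OF assms] lin_ext_def using assms by (simp add: endos_iff)
  finally show "lin_ext (\<lambda>m. \<phi> (Poly_Mapping.single m 1)) p = \<phi> p" ..
qed

lemma lookup_proj:
  "Poly_Mapping.lookup (proj b p) m = (if monom_deg m = b then Poly_Mapping.lookup p m else 0)"
  by (auto simp: proj_def lookup_sum lookup_single when_def in_keys_iff sum.delta
      if_distrib cong: if_cong)

lemma proj_add: "proj b (p + r) = proj b p + proj b r"
  by (auto intro!: poly_mapping_eqI simp: lookup_proj lookup_add)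

lemma proj_sum: "proj b (sum f A) = (\<Sum>x\<in>A. proj b (f x))"
  by (auto intro!: poly_mapping_eqI simp: lookup_proj lookup_sum)

lemma proj_graded_part:
  assumes "p \<in> graded_part b'" shows "proj b p = (if b' = b then p else 0)"
  using assms
  by (auto intro!: poly_mapping_eqI simp: lookup_proj graded_part_def in_keys_iff)

lemma single_in_graded_part: "Poly_Mapping.single m c \<in> graded_part (monom_deg m)"
  by (auto simp: graded_part_def)

lemma lin_ext_sum: "lin_ext (\<lambda>m. \<Sum>d\<in>D. f d m) = (\<lambda>p. \<Sum>d\<in>D. lin_ext (f d) p)"
  unfolding lin_ext_def pscale_sum by (rule ext, rule sum.swap)

lemma lin_ext_0: "lin_ext (\<lambda>_. 0) = (\<lambda>_. 0)"
  by (auto simp: lin_ext_def)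

lemma oper_comp_homogeneous:
  assumes "homogeneous d' \<phi>"
  shows "oper_comp d \<phi> = (if d' = d then \<phi> else (\<lambda>_. 0))"
proof -
  have *: "proj (\<lambda>i. monom_deg m i + d i) (\<phi> (Poly_Mapping.single m 1)) =
      (if d' = d then \<phi> (Poly_Mapping.single m 1) else 0)" for m
  proof -
    have "\<phi> (Poly_Mapping.single m 1) \<in> graded_part (\<lambda>i. monom_deg m i + d' i)"
      using assms single_in_graded_part unfolding homogeneous_def by blast
    from proj_graded_part[OF this] show ?thesis by (auto simp: fun_eq_iff)
  qed
  have "\<phi> \<in> endos" using assms by (simp add: homogeneous_def)
  then show ?thesis
    unfolding oper_comp_def * by (simp add: lin_ext_endo lin_ext_0)
qed

lemma oper_comp_sum_homogeneous:
  assumes "finite D" "\<And>d. d \<in> D \<Longrightarrow> homogeneous d (\<psi> d)"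
  shows "oper_comp d (\<lambda>p. \<Sum>d\<in>D. \<psi> d p) = (if d \<in> D then \<psi> d else (\<lambda>_. 0))"
proof -
  have "oper_comp d (\<lambda>p. \<Sum>d\<in>D. \<psi> d p) = (\<lambda>p. \<Sum>e\<in>D. oper_comp d (\<psi> e) p)"
    unfolding oper_comp_def proj_sum by (rule lin_ext_sum)
  also have "\<dots> = (\<lambda>p. \<Sum>e\<in>D. if e = d then \<psi> d p else 0)"
    using assms by (intro ext sum.cong) (simp_all add: oper_comp_homogeneous[OF assms(2)])
  finally show ?thesis using assms(1) by simp
qed

lemma twist_sum_homogeneous:
  assumes "finite D" "\<And>d. d \<in> D \<Longrightarrow> homogeneous d (\<psi> d)"
  shows "twist q a (\<lambda>p. \<Sum>d\<in>D. \<psi> d p) = (\<lambda>p. \<Sum>d\<in>D. pscale (bichar q a d) (\<psi> d p))"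
proof
  fix p
  have "{d. oper_comp d (\<lambda>p. \<Sum>d\<in>D. \<psi> d p) \<noteq> (\<lambda>_. 0)} = {d \<in> D. \<psi> d \<noteq> (\<lambda>_. 0)}"
    using oper_comp_sum_homogeneous[of D \<psi>, OF assms] by auto
  then have "twist q a (\<lambda>p. \<Sum>d\<in>D. \<psi> d p) p =
      (\<Sum>d\<in>{d \<in> D. \<psi> d \<noteq> (\<lambda>_. 0)}. pscale (bichar q a d) (\<psi> d p))"
    unfolding twist_def using oper_comp_sum_homogeneous[of D \<psi>, OF assms] by simp
  also have "\<dots> = (\<Sum>d\<in>D. pscale (bichar q a d) (\<psi> d p))"
    using assms(1) by (intro sum.mono_neutral_left) auto
  finally show "twist q a (\<lambda>p. \<Sum>d\<in>D. \<psi> d p) p = (\<Sum>d\<in>D. pscale (bichar q a d) (\<psi> d p))" .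
qed

lemma twist_homogeneous:
  assumes "homogeneous d \<phi>"
  shows "twist q a \<phi> = (\<lambda>p. pscale (bichar q a d) (\<phi> p))"
  using twist_sum_homogeneous[of "{d}" "\<lambda>_. \<phi>"] assms by simp

lemma zero_homogeneous: "homogeneous d (\<lambda>_. 0)"
  by (auto simp: homogeneous_def endos_iff graded_part_def)

lemma homogeneous_imp_grHom:
  assumes "homogeneous d \<phi>" shows "\<phi> \<in> grHom"
  unfolding grHom_def mem_Collect_eq using assms
  by (intro exI[of _ "{d}"] exI[of _ "\<lambda>_. \<phi>"]) auto

lemma graded_part_0: "0 \<in> graded_part b"
  by (auto simp: graded_part_def)

lemma graded_part_add: "p \<in> graded_part b \<Longrightarrow> r \<in> graded_part b \<Longrightarrow> p + r \<in> graded_part b"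
  using keys_add[of p r] by (auto simp: graded_part_def)

lemma homogeneous_add:
  assumes "homogeneous d \<phi>" "homogeneous d \<psi>"
  shows "homogeneous d (\<lambda>p. \<phi> p + \<psi> p)"
  using assms unfolding homogeneous_def image_subset_iff
  by (simp add: endos_iff pscale_add algebra_simps graded_part_add)

lemma grHom_add:
  assumes "\<phi> \<in> grHom" "\<psi> \<in> grHom"
  shows "(\<lambda>p. \<phi> p + \<psi> p) \<in> grHom"
proof -
  obtain D f where 1: "finite D" "\<forall>d\<in>D. homogeneous d (f d)" "\<phi> = (\<lambda>p. \<Sum>d\<in>D. f d p)"
    using assms(1) unfolding grHom_def by blast
  obtain E g where 2: "finite E" "\<forall>d\<in>E. homogeneous d (g d)" "\<psi> = (\<lambda>p. \<Sum>d\<in>E. g d p)"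
    using assms(2) unfolding grHom_def by blast
  define f' where "f' d = (if d \<in> D then f d else (\<lambda>_. 0))" for d
  define g' where "g' d = (if d \<in> E then g d else (\<lambda>_. 0))" for d
  have "\<phi> p = (\<Sum>d\<in>D \<union> E. f' d p)" for p
    unfolding 1(3) using 1(1) 2(1) by (intro sum.mono_neutral_cong_left) (auto simp: f'_def)
  moreover have "\<psi> p = (\<Sum>d\<in>D \<union> E. g' d p)" for p
    unfolding 2(3) using 1(1) 2(1) by (intro sum.mono_neutral_cong_left) (auto simp: g'_def)
  ultimately have "(\<lambda>p. \<phi> p + \<psi> p) = (\<lambda>p. \<Sum>d\<in>D \<union> E. f' d p + g' d p)"
    by (simp add: sum.distrib)
  moreover have "homogeneous d (\<lambda>p. f' d p + g' d p)" for d
    using 1(2) 2(2) by (intro homogeneous_add) (auto simp: f'_def g'_def zero_homogeneous)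
  ultimately show ?thesis
    unfolding grHom_def using 1(1) 2(1)
    by (intro CollectI exI[of _ "D \<union> E"] exI[of _ "\<lambda>d p. f' d p + g' d p"]) auto
qed

lemma grHom_sum:
  assumes "\<And>x. x \<in> A \<Longrightarrow> f x \<in> grHom"
  shows "(\<lambda>p. \<Sum>x\<in>A. f x p) \<in> grHom"
  using assms
proof (induction A rule: infinite_finite_induct)
  case (insert x A)
  then show ?case using grHom_add[of "f x" "\<lambda>p. \<Sum>x\<in>A. f x p"] by simp
qed (auto intro: homogeneous_imp_grHom zero_homogeneous)

lemma homogeneous_comp:
  assumes "homogeneous d \<phi>" "homogeneous e \<psi>"
  shows "homogeneous (\<lambda>i. e i + d i) (\<phi> \<circ> \<psi>)"
proof -
  have "\<phi> \<circ> \<psi> \<in> endos" using assms by (auto simp: homogeneous_def endos_iff)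
  moreover have "\<phi> (\<psi> p) \<in> graded_part (\<lambda>i. b i + (e i + d i))" if "p \<in> graded_part b" for b p
  proof -
    have "\<psi> p \<in> graded_part (\<lambda>i. b i + e i)" using assms(2) that unfolding homogeneous_def by blast
    then have "\<phi> (\<psi> p) \<in> graded_part (\<lambda>i. (b i + e i) + d i)"
      using assms(1) unfolding homogeneous_def by blast
    then show ?thesis by (simp add: add.assoc)
  qed
  ultimately show ?thesis by (auto simp: homogeneous_def)
qed

lemma grHom_comp:
  assumes "\<phi> \<in> grHom" "\<psi> \<in> grHom"
  shows "\<phi> \<circ> \<psi> \<in> grHom"
proof -
  obtain D f where 1: "finite D" "\<forall>d\<in>D. homogeneous d (f d)" "\<phi> = (\<lambda>p. \<Sum>d\<in>D. f d p)"
    using assms(1) unfolding grHom_def by blast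
  obtain E g where 2: "finite E" "\<forall>d\<in>E. homogeneous d (g d)" "\<psi> = (\<lambda>p. \<Sum>d\<in>E. g d p)"
    using assms(2) unfolding grHom_def by blast
  have "f d (\<Sum>e\<in>E. g e p) = (\<Sum>e\<in>E. f d (g e p))" if "d \<in> D" for d p
    using 1(2) that by (intro endos_sum) (auto simp: homogeneous_def)
  then have "\<phi> \<circ> \<psi> = (\<lambda>p. \<Sum>d\<in>D. \<Sum>e\<in>E. (f d \<circ> g e) p)"
    by (auto simp: 1(3) 2(3))
  moreover have "f d \<circ> g e \<in> grHom" if "d \<in> D" "e \<in> E" for d e
    using that 1(2) 2(2) by (auto intro: homogeneous_imp_grHom homogeneous_comp)
  then have "(\<lambda>p. \<Sum>d\<in>D. \<Sum>e\<in>E. (f d \<circ> g e) p) \<in> grHom"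
    by (intro grHom_sum)
  ultimately show ?thesis by simp
qed

lemma mult_monom_homogeneous:
  "homogeneous (monom_deg m) (mult_oper (Poly_Mapping.single m c))"
proof -
  have "monom_deg k = (\<lambda>i. b i + monom_deg m i)"
    if p: "p \<in> graded_part b" and k: "k \<in> Poly_Mapping.keys (Poly_Mapping.single m c * p)" for b p k
  proof -
    obtain l where "k = m + l" "l \<in> Poly_Mapping.keys p"
      using k keys_mult[of "Poly_Mapping.single m c" p] by (auto split: if_splits)
    then show ?thesis using p by (auto simp: graded_part_def monom_deg_def lookup_add fun_eq_iff)
  qed
  then show ?thesis
    by (auto simp: homogeneous_def endos_iff mult_oper_def graded_part_def pscale_def algebra_simps)
qed

lemma mult_oper_grHom: "mult_oper r \<in> grHom"
proof -
  have *: "r = (\<Sum>m\<in>Poly_Mapping.keys r. Poly_Mapping.single m (Poly_Mapping.lookup r m))"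
    by (auto intro!: poly_mapping_eqI
      simp: lookup_sum lookup_single when_def in_keys_iff sum.delta if_distrib cong: if_cong)
  have "mult_oper r = (\<lambda>p. \<Sum>m\<in>Poly_Mapping.keys r.
          mult_oper (Poly_Mapping.single m (Poly_Mapping.lookup r m)) p)"
    unfolding mult_oper_def by (rule ext, subst *, rule sum_distrib_right)
  also have "\<dots> \<in> grHom"
    by (intro grHom_sum homogeneous_imp_grHom[OF mult_monom_homogeneous])
  finally show ?thesis .
qed

lemma sub_bimodule_grHom: "sub_bimodule grHom"
  by (auto simp: sub_bimodule_def grHom_add grHom_comp mult_oper_grHom
      intro: homogeneous_imp_grHom[OF zero_homogeneous])

lemma partial_monom:
  "partial i (Poly_Mapping.single m 1) =
     Poly_Mapping.single (m - Poly_Mapping.single i 1) (of_nat (Poly_Mapping.lookup m i))"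
  by (simp add: partial_def lin_ext_def pscale_def)

lemma q_partial_monom:
  "q_partial q k i (Poly_Mapping.single m 1) =
     Poly_Mapping.single (m - Poly_Mapping.single i 1)
       ((q i powi (k * int (Poly_Mapping.lookup m i)) - 1) / (q i - 1))"
  by (simp add: q_partial_def lin_ext_def pscale_def)

end

theory Submission
  imports Defs
begin

text \<open>
  A homogeneous operator of degree \<open>d\<close> sends \<open>x\<^sup>m\<close> to \<open>F(m) x\<^bsup>m + d\<^esup>\<close> for a weight function \<open>F\<close> on
  exponent vectors, and \<open>F(m) = 0\<close> whenever \<open>m + d\<close> has a negative entry. The idea is to describe
  \<open>D\<^sub>q\<close> explicitly: it consists of the finite sums of such operators whose weights are exponential
  polynomials, that is, lie in the ring generated by constants, the coordinates \<open>m\<^sub>i\<close> and the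
  functions \<open>q\<^sub>i\<^bsup>m\<^sub>i\<^esup>\<close> and \<open>q\<^sub>i\<^bsup>-m\<^sub>i\<^esup>\<close>. Let \<open>P\<close> be the set of these operators
  (\<open>polyexp_opers\<close>) and \<open>A\<close> the subalgebra of the theorem. The proof closes the circle
  \<open>D\<^sub>q \<subseteq> P \<subseteq> A \<subseteq> D\<^sub>q\<close>.

  \<open>D\<^sub>q \<subseteq> P\<close>: the bracket with \<open>x\<^sub>i\<close> changes the weight \<open>F\<close> into
  \<open>F(m + e\<^sub>i) - q\<^sub>i\<^bsup>a\<^sub>i\<^esup> F(m)\<close>. If these differences are exponential polynomials for all \<open>i\<close>, so is
  \<open>F\<close> (\<open>polyexp_if_differences\<close>), because the difference operators are surjective on exponential
  polynomials and the solutions of the homogeneous equations are exponentials. Surjectivity uses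
  that \<open>q\<^sub>i\<close> is not a root of unity and that the characteristic is zero.

  \<open>P \<subseteq> A\<close>: the operators \<open>x\<^sub>i \<partial>\<^sub>i\<close> and \<open>x\<^sub>i \<partial>\<^sub>i\<^bsup>\<beta>\<^esup>\<close> and their variant for the inverse of \<open>q\<^sub>i\<close> give all
  exponential polynomials in degree \<open>0\<close>. If \<open>d\<^sub>i = - c - 1\<close> is negative, \<open>F\<close> vanishes at
  \<open>m\<^sub>i = 0, \<dots>, c\<close>; then \<open>F = (m\<^sub>i - c) G + (q\<^sub>i\<^bsup>m\<^sub>i\<^esup> - q\<^sub>i\<^sup>c) H\<close> with \<open>G\<close> and \<open>H\<close> admissible in degree
  \<open>d + e\<^sub>i\<close> (\<open>polyexp_split_root\<close>), and the two factors are realized by \<open>\<partial>\<^sub>i\<close> and \<open>\<partial>\<^sub>i\<^bsup>\<beta>\<^esup>\<close>.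

  \<open>A \<subseteq> D\<^sub>q\<close>: orders add under composition by a Leibniz rule for brackets (\<open>Dq_filt_comp\<close>), so \<open>D\<^sub>q\<close>
  is an algebra, and the three kinds of derivatives are twisted derivations and have order one.
\<close>

section \<open>Exponential polynomials on exponent vectors\<close>

inductive_set polyexp :: "('n \<Rightarrow> 'k::field_char_0) \<Rightarrow> ('n expo \<Rightarrow> 'k) set" for q where
  const: "(\<lambda>_. c) \<in> polyexp q"
| coord: "(\<lambda>m. of_nat (Poly_Mapping.lookup m i)) \<in> polyexp q"
| expn: "(\<lambda>m. q i ^ Poly_Mapping.lookup m i) \<in> polyexp q"
| expn_inv: "(\<lambda>m. inverse (q i) ^ Poly_Mapping.lookup m i) \<in> polyexp q"
| add: "f \<in> polyexp q \<Longrightarrow> g \<in> polyexp q \<Longrightarrow> (\<lambda>m. f m + g m) \<in> polyexp q"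
| mult: "f \<in> polyexp q \<Longrightarrow> g \<in> polyexp q \<Longrightarrow> (\<lambda>m. f m * g m) \<in> polyexp q"

lemma polyexp_diff:
  assumes "f \<in> polyexp q" "g \<in> polyexp q" shows "(\<lambda>m. f m - g m) \<in> polyexp q"
  using polyexp.add[OF assms(1) polyexp.mult[OF polyexp.const[of "-1"] assms(2)]] by simp

lemma polyexp_scale:
  assumes "f \<in> polyexp q" shows "(\<lambda>m. c * f m) \<in> polyexp q"
  using polyexp.mult[OF polyexp.const assms] .

lemma polyexp_power:
  assumes "f \<in> polyexp q" shows "(\<lambda>m. f m ^ k) \<in> polyexp q"
  by (induction k) (auto intro: polyexp.const polyexp.mult assms)

lemma polyexp_prod:
  assumes "\<And>x. x \<in> A \<Longrightarrow> f x \<in> polyexp q" shows "(\<lambda>m. \<Prod>x\<in>A. f x m) \<in> polyexp q"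
  using assms by (induction A rule: infinite_finite_induct) (auto intro: polyexp.const polyexp.mult)

lemma polyexp_powi:
  "(\<lambda>m. (q i powi c) ^ Poly_Mapping.lookup m i) \<in> polyexp q"
proof (cases "c \<ge> 0")
  case True
  then have "(q i powi c) ^ l = (q i ^ l) ^ nat c" for l
    by (simp add: power_int_def power_mult[symmetric] mult.commute)
  then show ?thesis by (simp add: polyexp_power polyexp.expn)
next
  case False
  then have "(q i powi c) ^ l = (inverse (q i) ^ l) ^ nat (- c)" for l
    by (simp add: power_int_def power_mult[symmetric] mult.commute)
  then show ?thesis by (simp add: polyexp_power polyexp.expn_inv)
qed

text \<open>
  This covers the three substitutions that occur: translating by a monomial, freezing one
  coordinate, and keeping only a set of coordinates.
\<close>

lemma polyexp_subst:
  assumes "f \<in> polyexp q"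
    and T: "\<And>i. (\<exists>k. \<forall>m. Poly_Mapping.lookup (T m) i = Poly_Mapping.lookup m i + k) \<or>
                (\<exists>k. \<forall>m. Poly_Mapping.lookup (T m) i = k)"
  shows "(\<lambda>m. f (T m)) \<in> polyexp q"
  using assms(1)
proof induction
  case (coord i)
  show ?case using T[of i] by (auto intro: polyexp.intros intro!: polyexp.add)
next
  case (expn i)
  show ?case using T[of i] by (auto intro: polyexp.intros intro!: polyexp.mult simp: power_add)
next
  case (expn_inv i)
  show ?case using T[of i] by (auto intro: polyexp.intros intro!: polyexp.mult simp: power_add)
qed (auto intro: polyexp.intros)

lemma polyexp_update:
  "f \<in> polyexp q \<Longrightarrow> (\<lambda>m. f (Poly_Mapping.update i c m)) \<in> polyexp q"
  by (rule polyexp_subst) (auto simp: lookup_update)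

lemma polyexp_translate:
  "f \<in> polyexp q \<Longrightarrow> (\<lambda>m. f (m + k)) \<in> polyexp q"
  by (rule polyexp_subst) (auto simp: lookup_add)

section \<open>First-order difference equations\<close>

definition indep_of :: "'n \<Rightarrow> ('n expo \<Rightarrow> 'k) \<Rightarrow> bool"
  where "indep_of i h \<longleftrightarrow> (\<forall>n m. h (Poly_Mapping.update i n m) = h m)"

lemma update_lookup [simp]: "Poly_Mapping.update i (Poly_Mapping.lookup m i) m = m"
  by (auto intro!: poly_mapping_eqI simp: lookup_update)

lemma update_update [simp]:
  "Poly_Mapping.update i a (Poly_Mapping.update i b m) = Poly_Mapping.update i a m"
  by (auto intro!: poly_mapping_eqI simp: lookup_update)

lemma plus_unit_eq_update:
  "m + Poly_Mapping.single i 1 = Poly_Mapping.update i (Suc (Poly_Mapping.lookup m i)) m"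
  by (auto intro!: poly_mapping_eqI simp: lookup_update lookup_add lookup_single when_def)

text \<open>
  Normal form with respect to one coordinate: the dependence on \<open>m\<^sub>i\<close> is made explicit, and
  the remaining factor does not see \<open>m\<^sub>i\<close>. The exponent \<open>c\<close> is an integer, so that \<open>q\<^sub>i\<close> and its
  inverse are treated together.
\<close>

inductive_set separated :: "('n \<Rightarrow> 'k::field_char_0) \<Rightarrow> 'n \<Rightarrow> ('n expo \<Rightarrow> 'k) set" for q i where
  monomial: "h \<in> polyexp q \<Longrightarrow> indep_of i h \<Longrightarrow>
    (\<lambda>m. of_nat (Poly_Mapping.lookup m i) ^ k * (q i powi c) ^ Poly_Mapping.lookup m i * h m)
      \<in> separated q i"
| add: "f \<in> separated q i \<Longrightarrow> g \<in> separated q i \<Longrightarrow> (\<lambda>m. f m + g m) \<in> separated q i"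

lemma separated_mult:
  assumes q0: "q i \<noteq> 0" and "f \<in> separated q i" "g \<in> separated q i"
  shows "(\<lambda>m. f m * g m) \<in> separated q i"
  using assms(2)
proof induction
  case (monomial h k c)
  from assms(3) show ?case
  proof induction
    case (monomial h' k' c')
    have "(\<lambda>m. h m * h' m) \<in> polyexp q" "indep_of i (\<lambda>m. h m * h' m)"
      using monomial \<open>h \<in> _\<close> \<open>indep_of i h\<close> by (auto intro: polyexp.mult simp: indep_of_def)
    from separated.monomial[OF this, of "k + k'" "c + c'"]
    show ?case using q0 by (simp add: power_int_add power_add power_mult_distrib mult_ac)
  next
    case (add f g)
    from separated.add[OF add.IH] show ?case by (simp add: algebra_simps)
  qed
next
  case (add f g)
  from separated.add[OF add.IH] show ?case by (simp add: algebra_simps)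
qed

lemma polyexp_separated:
  fixes q :: "'n \<Rightarrow> 'k::field_char_0"
  assumes q0: "q i \<noteq> 0" and "f \<in> polyexp q"
  shows "f \<in> separated q i"
proof -
  have h: "h \<in> separated q i" if "h \<in> polyexp q" "indep_of i h" for h
    using separated.monomial[OF that, of 0 0] by simp
  have one: "(\<lambda>_. 1) \<in> polyexp q" "indep_of i (\<lambda>_. 1 :: 'k)"
    by (auto intro: polyexp.const simp: indep_of_def)
  show ?thesis using assms(2)
  proof induction
    case (const c)
    show ?case by (rule h) (auto intro: polyexp.const simp: indep_of_def)
  next
    case (coord j)
    show ?case
    proof (cases "j = i")
      case True
      with separated.monomial[OF one, of 1 0] show ?thesis by simp
    next
      case False
      then show ?thesis by (intro h) (auto intro: polyexp.coord simp: indep_of_def lookup_update)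
    qed
  next
    case (expn j)
    show ?case
    proof (cases "j = i")
      case True
      with separated.monomial[OF one, of 0 1] show ?thesis by simp
    next
      case False
      then show ?thesis by (intro h) (auto intro: polyexp.expn simp: indep_of_def lookup_update)
    qed
  next
    case (expn_inv j)
    show ?case
    proof (cases "j = i")
      case True
      with separated.monomial[OF one, of 0 "-1"] show ?thesis by (simp add: power_int_minus)
    next
      case False
      then show ?thesis by (intro h) (auto intro: polyexp.expn_inv simp: indep_of_def lookup_update)
    qed
  next
    case (add f g)
    show ?case using add.IH by (rule separated.add)
  next
    case (mult f g)
    show ?case using q0 mult.IH by (rule separated_mult)
  qed
qed

definition differences :: "('n \<Rightarrow> 'k::field_char_0) \<Rightarrow> 'n \<Rightarrow> int \<Rightarrow> ('n expo \<Rightarrow> 'k) set"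
  where "differences q i a =
    {f. \<exists>g\<in>polyexp q. \<forall>m. f m = g (m + Poly_Mapping.single i 1) - q i powi a * g m}"

lemma differences_add:
  assumes "f \<in> differences q i a" "g \<in> differences q i a"
  shows "(\<lambda>m. f m + g m) \<in> differences q i a"
proof -
  from assms obtain f' g' where f': "f' \<in> polyexp q" "g' \<in> polyexp q"
    and *: "\<And>m. f m = f' (m + Poly_Mapping.single i 1) - q i powi a * f' m"
        "\<And>m. g m = g' (m + Poly_Mapping.single i 1) - q i powi a * g' m"
    unfolding differences_def by blast
  show ?thesis unfolding differences_def *
    by (intro CollectI bexI[OF _ polyexp.add[OF f']]) (simp add: algebra_simps)
qed

lemma differences_scale:
  assumes "f \<in> differences q i a" shows "(\<lambda>m. c * f m) \<in> differences q i a"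
proof -
  from assms obtain f' where f': "f' \<in> polyexp q"
    and *: "\<And>m. f m = f' (m + Poly_Mapping.single i 1) - q i powi a * f' m"
    unfolding differences_def by blast
  show ?thesis unfolding differences_def *
    by (intro CollectI bexI[OF _ polyexp_scale[OF f', of c]]) (simp add: algebra_simps)
qed

lemma differences_lincomb:
  fixes k :: nat
  assumes "g \<in> differences q i a" "\<And>j. j < k \<Longrightarrow> f j \<in> differences q i a"
  shows "(\<lambda>m. c * g m + (\<Sum>j<k. b j * f j m)) \<in> differences q i a"
  using assms(2)
proof (induction k)
  case 0
  then show ?case using differences_scale[OF assms(1)] by simp
next
  case (Suc k)
  then have "(\<lambda>m. c * g m + (\<Sum>j<k. b j * f j m)) \<in> differences q i a" by simp
  from differences_add[OF this differences_scale[OF Suc.prems[of k], of "b k"]]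
  show ?case by (simp add: algebra_simps)
qed

text \<open>
  The leading term of the binomial expansion is kept apart, since it is the one that the
  difference operator either rescales or kills.
\<close>

lemma binomial_head:
  "(of_nat (Suc l) :: 'k::comm_ring_1) ^ k = of_nat l ^ k + (\<Sum>j<k. of_nat (k choose j) * of_nat l ^ j)"
proof -
  have "(of_nat (Suc l) :: 'k) ^ k = (of_nat l + 1) ^ k" by (simp add: add.commute)
  also have "\<dots> = (\<Sum>j\<le>k. of_nat (k choose j) * of_nat l ^ j)" by (simp add: binomial_ring)
  also have "{..k} = insert k {..<k}" by auto
  finally show ?thesis by simp
qed

text \<open>
  The difference operator is triangular on the monomials \<open>M k = m\<^sub>i\<^sup>k q\<^sub>i\<^bsup>c m\<^sub>i\<^esup> h\<close> for fixed \<open>c\<close>. If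
  \<open>c \<noteq> a\<close>, its diagonal entries \<open>q\<^sub>i\<^sup>c - q\<^sub>i\<^sup>a\<close> do not vanish. In the resonant case \<open>c = a\<close> the
  diagonal is zero, but the entry just below it is \<open>q\<^sub>i\<^sup>c (k + 1)\<close>, a unit in characteristic zero,
  so the image of \<open>M (k + 1)\<close> starts with \<open>M k\<close>. Either way induction on \<open>k\<close> applies.
\<close>

lemma monomial_in_differences:
  assumes q0: "q i \<noteq> 0" and inj: "\<And>c. c \<noteq> a \<Longrightarrow> q i powi c \<noteq> q i powi a"
    and h: "h \<in> polyexp q" "indep_of i h"
  shows "(\<lambda>m. of_nat (Poly_Mapping.lookup m i) ^ k * (q i powi c) ^ Poly_Mapping.lookup m i * h m)
      \<in> differences q i a"
proof -
  define M where "M k = (\<lambda>m. of_nat (Poly_Mapping.lookup m i) ^ k *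
      (q i powi c) ^ Poly_Mapping.lookup m i * h m)" for k
  define E where "E k = (\<lambda>m. M k (m + Poly_Mapping.single i 1) - q i powi a * M k m)" for k
  have E_diff: "E k \<in> differences q i a" for k
    unfolding differences_def E_def M_def
    by (intro CollectI bexI[of _ "M k"] allI)
       (auto simp: M_def intro!: polyexp.mult polyexp_power polyexp_powi polyexp.coord h)
  \<comment> \<open>Triangularity: the image of \<open>M k\<close> involves only \<open>M j\<close> with \<open>j \<le> k\<close>.\<close>
  have E_eq: "E k m = (q i powi c - q i powi a) * M k m +
      q i powi c * (\<Sum>j<k. of_nat (k choose j) * M j m)" for k m
  proof -
    have hh: "h (m + Poly_Mapping.single i 1) = h m"
      using h(2) unfolding plus_unit_eq_update indep_of_def by blast
    have "M k (m + Poly_Mapping.single i 1) = of_nat (Suc (Poly_Mapping.lookup m i)) ^ k *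
        q i powi c * (q i powi c) ^ Poly_Mapping.lookup m i * h m"
      unfolding M_def hh by (simp add: lookup_add lookup_single mult_ac)
    also have "\<dots> = q i powi c * (M k m + (\<Sum>j<k. of_nat (k choose j) * M j m))"
      unfolding binomial_head M_def by (simp add: algebra_simps sum_distrib_left)
    finally show ?thesis by (simp add: E_def algebra_simps)
  qed
  have "M k \<in> differences q i a"
  proof (induction k rule: less_induct)
    case (less k)
    show ?case
    proof (cases "c = a")
      case False
      define D where "D = q i powi c - q i powi a"
      have D: "D \<noteq> 0" using inj[OF False] by (simp add: D_def)
      have "M k m = (1 / D) * E k m + (\<Sum>j<k. (- (q i powi c) * of_nat (k choose j) / D) * M j m)" for m
      proof -
        have "(\<Sum>j<k. (- (q i powi c) * of_nat (k choose j) / D) * M j m) =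
            (- (q i powi c) / D) * (\<Sum>j<k. of_nat (k choose j) * M j m)"
          unfolding sum_distrib_left by (rule sum.cong) auto
        then show ?thesis unfolding E_eq D_def[symmetric] using D by (simp add: field_simps)
      qed
      then have "M k = (\<lambda>m. (1 / D) * E k m + (\<Sum>j<k. (- (q i powi c) * of_nat (k choose j) / D) * M j m))"
        by blast
      also have "\<dots> \<in> differences q i a" by (rule differences_lincomb[OF E_diff less])
      finally show ?thesis .
    next
      case True
      define D where "D = q i powi c * of_nat (Suc k)"
      have D: "D \<noteq> 0" using q0 by (simp add: D_def del: of_nat_Suc)
      \<comment> \<open>The diagonal term of \<open>E (Suc k)\<close> vanishes, and \<open>D\<close> is the coefficient of \<open>M k\<close> in it.\<close>
      have "M k m = (1 / D) * E (Suc k) m +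
          (\<Sum>j<k. (- (q i powi c) * of_nat (Suc k choose j) / D) * M j m)" for m
      proof -
        have 1: "(\<Sum>j<k. (- (q i powi c) * of_nat (Suc k choose j) / D) * M j m) =
            (- (q i powi c) / D) * (\<Sum>j<k. of_nat (Suc k choose j) * M j m)"
          unfolding sum_distrib_left by (rule sum.cong) auto
        have "E (Suc k) m = D * M k m + q i powi c * (\<Sum>j<k. of_nat (Suc k choose j) * M j m)"
          unfolding E_eq True D_def sum.lessThan_Suc by (simp add: algebra_simps)
        then show ?thesis unfolding 1 using D by (simp add: field_simps)
      qed
      then have "M k = (\<lambda>m. (1 / D) * E (Suc k) m +
          (\<Sum>j<k. (- (q i powi c) * of_nat (Suc k choose j) / D) * M j m))"
        by blast
      also have "\<dots> \<in> differences q i a" by (rule differences_lincomb[OF E_diff less])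
      finally show ?thesis .
    qed
  qed
  then show ?thesis by (simp add: M_def)
qed

lemma polyexp_antidifference:
  assumes q0: "q i \<noteq> 0" and inj: "\<And>c. c \<noteq> a \<Longrightarrow> q i powi c \<noteq> q i powi a"
    and "f \<in> polyexp q"
  shows "f \<in> differences q i a"
  using polyexp_separated[OF q0 assms(3)]
proof induction
  case (monomial h k c)
  then show ?case by (intro monomial_in_differences q0 inj)
next
  case (add f g)
  show ?case by (rule differences_add[OF add.IH])
qed

definition keep :: "'n set \<Rightarrow> 'n expo \<Rightarrow> 'n::finite expo"
  where "keep J m = Poly_Mapping.Abs_poly_mapping (\<lambda>i. if i \<in> J then Poly_Mapping.lookup m i else 0)"

lemma lookup_keep [simp]:
  "Poly_Mapping.lookup (keep J m) i = (if i \<in> J then Poly_Mapping.lookup m i else 0)"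
  unfolding keep_def by (subst Abs_poly_mapping_inverse) auto

text \<open>
  In direction \<open>j\<close>, subtracting an exponential polynomial \<open>G\<close> with the same difference leaves a
  solution of the homogeneous equation, which is \<open>q\<^sub>j\<^bsup>a\<^sub>j m\<^sub>j\<^esup>\<close> times its value at \<open>m\<^sub>j = 0\<close>. Thus \<open>f\<close>
  is determined by its restriction to \<open>m\<^sub>j = 0\<close> up to exponential polynomials. Releasing the
  coordinates one after the other starts from the constant \<open>f(0)\<close> and ends with \<open>f\<close>.
\<close>

lemma polyexp_if_differences:
  fixes q :: "'n::finite \<Rightarrow> 'k::field_char_0"
  assumes q0: "\<And>i. q i \<noteq> 0" and inj: "\<And>i a b. a \<noteq> b \<Longrightarrow> q i powi a \<noteq> q i powi b"
    and f: "\<And>i. (\<lambda>m. f (m + Poly_Mapping.single i 1) - q i powi a i * f m) \<in> polyexp q"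
  shows "f \<in> polyexp q"
proof -
  have "(\<lambda>m. f (keep J m)) \<in> polyexp q" for J
    using finite[of J]
  proof (induction J rule: finite_induct)
    case empty
    have "keep {} m = 0" for m :: "'n expo" by (auto intro!: poly_mapping_eqI)
    then show ?case by (simp add: polyexp.const)
  next
    case (insert j J)
    from polyexp_antidifference[of q j, OF q0 inj f[of j]] obtain G where G: "G \<in> polyexp q"
      and "\<forall>m. f (m + Poly_Mapping.single j 1) - q j powi a j * f m =
            G (m + Poly_Mapping.single j 1) - q j powi a j * G m"
      unfolding differences_def by blast
    then have step: "f (m + Poly_Mapping.single j 1) - G (m + Poly_Mapping.single j 1) =
        q j powi a j * (f m - G m)" for m by (simp add: algebra_simps)
    \<comment> \<open>The difference \<open>f - G\<close> solves the homogeneous equation, so it is geometric in \<open>m\<^sub>j\<close>.\<close>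
    have iter: "f (Poly_Mapping.update j l m) - G (Poly_Mapping.update j l m) =
        (q j powi a j) ^ l * (f (Poly_Mapping.update j 0 m) - G (Poly_Mapping.update j 0 m))" for l m
    proof (induction l)
      case (Suc l)
      have "Poly_Mapping.update j (Suc l) m = Poly_Mapping.update j l m + Poly_Mapping.single j 1"
        unfolding plus_unit_eq_update by (simp add: lookup_update)
      then show ?case using Suc step by simp
    qed simp
    have "f (keep (insert j J) m) = G (keep (insert j J) m) +
        (q j powi a j) ^ Poly_Mapping.lookup m j * (f (keep J m) - G (keep J m))" for m
    proof -
      have 0: "Poly_Mapping.update j 0 (keep (insert j J) m) = keep J m"
        using insert.hyps by (auto intro!: poly_mapping_eqI simp: lookup_update)
      have "Poly_Mapping.update j (Poly_Mapping.lookup m j) (keep (insert j J) m) = keep (insert j J) m"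
        by (auto intro!: poly_mapping_eqI simp: lookup_update)
      with iter[of "Poly_Mapping.lookup m j" "keep (insert j J) m"] show ?thesis
        unfolding 0 by (simp add: algebra_simps)
    qed
    moreover have "(\<lambda>m. G (keep J m)) \<in> polyexp q" for J
      by (rule polyexp_subst[OF G]) auto
    ultimately show ?case
      using insert.IH by (auto intro!: polyexp.add polyexp.mult polyexp_diff polyexp_powi)
  qed
  moreover have "keep UNIV m = m" for m :: "'n expo" by (auto intro!: poly_mapping_eqI)
  ultimately show ?thesis by (metis (no_types, lifting) ext)
qed

section \<open>Splitting off a zero in one coordinate\<close>

text \<open>
  Gaussian elimination for a matrix \<open>F\<close> of finite rank, with rows indexed by \<open>n\<close>: a finite
  decomposition can be chosen with all row factors in any space \<open>V\<close> that contains the rows of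
  \<open>F\<close>. If \<open>w(n\<^sub>0) \<noteq> 0\<close> for the first column factor, then removing the multiple \<open>w / w(n\<^sub>0)\<close> of the
  row \<open>F n\<^sub>0\<close> cancels the first summand, and the remaining matrix has a shorter decomposition and
  still has rows in \<open>V\<close>.
\<close>

lemma rank_reduction:
  fixes F :: "nat \<Rightarrow> 'y \<Rightarrow> 'k::field"
  assumes "\<And>n y. F n y = (\<Sum>(w,h)\<leftarrow>ws. w n * h y)"
    and "\<And>w h. (w,h) \<in> set ws \<Longrightarrow> w \<in> W"
    and W: "\<And>c w w'. w \<in> W \<Longrightarrow> w' \<in> W \<Longrightarrow> (\<lambda>n. w n - c * w' n) \<in> W"
      "\<And>c w. w \<in> W \<Longrightarrow> (\<lambda>n. c * w n) \<in> W"
    and V: "\<And>c v v'. v \<in> V \<Longrightarrow> v' \<in> V \<Longrightarrow> (\<lambda>y. v y - c * v' y) \<in> V"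
    and "\<And>n. F n \<in> V"
  shows "\<exists>us. set us \<subseteq> W \<times> V \<and> (\<forall>n y. F n y = (\<Sum>(u,v)\<leftarrow>us. u n * v y))"
  using assms(1,2,6)
proof (induction "length ws" arbitrary: ws F)
  case 0
  then show ?case by (intro exI[of _ "[]"]) auto
next
  case (Suc l)
  then obtain w h ws' where ws: "ws = (w,h) # ws'" by (cases ws) auto
  have l: "length ws' = l" using Suc.hyps(2) ws by simp
  have w: "w \<in> W" using Suc.prems(2) ws by auto
  show ?case
  proof (cases "\<forall>n. w n = 0")
    case True
    have "F n y = (\<Sum>(w,h)\<leftarrow>ws'. w n * h y)" for n y
      unfolding Suc.prems(1) ws using True by simp
    moreover have "w' \<in> W" if "(w',h') \<in> set ws'" for w' h'
      using that Suc.prems(2) unfolding ws by auto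
    ultimately show ?thesis by (rule Suc.hyps(1)[OF l[symmetric] _ _ Suc.prems(3)])
  next
    case False
    then obtain n0 where n0: "w n0 \<noteq> 0" by blast
    define u where "u n = w n / w n0" for n
    have u: "u \<in> W" using W(2)[OF w, of "1 / w n0"] by (simp add: u_def[abs_def])
    define F' where "F' n y = F n y - u n * F n0 y" for n y
    define f where "f = (\<lambda>(w',h'). ((\<lambda>n. w' n - w' n0 * u n) :: nat \<Rightarrow> 'k, h' :: 'y \<Rightarrow> 'k))"
    have *: "(\<Sum>(w',h')\<leftarrow>xs. w' n * h' y) - u n * (\<Sum>(w',h')\<leftarrow>xs. w' n0 * h' y) =
        (\<Sum>(w',h')\<leftarrow>map f xs. w' n * h' y)" for n y xs
      by (induction xs) (auto simp: f_def algebra_simps)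
    have "F' n y = (\<Sum>(w',h')\<leftarrow>map f ws'. w' n * h' y)" for n y
      unfolding *[symmetric] F'_def Suc.prems(1) ws using n0 by (simp add: u_def algebra_simps)
    moreover have "w' \<in> W" if "(w',h') \<in> set (map f ws')" for w' h'
      using that Suc.prems(2) W(1)[OF _ u] unfolding ws by (auto simp: f_def)
    moreover have "F' n \<in> V" for n
      using V[OF Suc.prems(3)[of n] Suc.prems(3)[of n0], of "u n"] by (simp add: F'_def[abs_def])
    ultimately obtain us where us: "set us \<subseteq> W \<times> V"
      and F': "\<And>n y. F' n y = (\<Sum>(u,v)\<leftarrow>us. u n * v y)"
      using Suc.hyps(1)[of "map f ws'" F'] l by (metis length_map)
    have "F n y = (\<Sum>(u,v)\<leftarrow>(u, F n0) # us. u n * v y)" for n y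
      using F'[of n y] by (simp add: F'_def algebra_simps)
    moreover have "set ((u, F n0) # us) \<subseteq> W \<times> V"
      using us u Suc.prems(3)[of n0] by simp
    ultimately show ?thesis by (intro exI[of _ "(u, F n0) # us"] conjI allI)
  qed
qed

lemma separated_sum_list:
  assumes "f \<in> separated q i"
  shows "\<exists>ws. (\<forall>(w,h)\<in>set ws. (\<lambda>m. w (Poly_Mapping.lookup m i)) \<in> polyexp q) \<and>
    (\<forall>n m. f (Poly_Mapping.update i n m) = (\<Sum>(w,h)\<leftarrow>ws. w n * h m))"
  using assms
proof induction
  case (monomial h k c)
  have h: "h (Poly_Mapping.update i n m) = h m" for n m
    using monomial by (auto simp: indep_of_def)
  show ?case
    by (rule exI[of _ "[(\<lambda>n. of_nat n ^ k * (q i powi c) ^ n, h)]"])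
       (auto simp: h lookup_update intro!: polyexp.mult polyexp_power polyexp_powi polyexp.coord)
next
  case (add f g)
  from add.IH obtain ws ws' where
    "\<forall>(w,h)\<in>set ws. (\<lambda>m. w (Poly_Mapping.lookup m i)) \<in> polyexp q"
    "\<forall>n m. f (Poly_Mapping.update i n m) = (\<Sum>(w,h)\<leftarrow>ws. w n * h m)"
    "\<forall>(w,h)\<in>set ws'. (\<lambda>m. w (Poly_Mapping.lookup m i)) \<in> polyexp q"
    "\<forall>n m. g (Poly_Mapping.update i n m) = (\<Sum>(w,h)\<leftarrow>ws'. w n * h m)" by blast
  then show ?case by (intro exI[of _ "ws @ ws'"]) auto
qed

text \<open>
  The exponential polynomials in \<open>m\<^sub>i\<close> are the values of Laurent polynomials in \<open>t = m\<^sub>i\<close> and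
  \<open>s = q\<^sub>i\<^bsup>m\<^sub>i\<^esup>\<close>, and the ideal of the point \<open>(c, q\<^sub>i\<^sup>c)\<close> is generated by \<open>t - c\<close> and
  \<open>s - q\<^sub>i\<^sup>c\<close>. Both factors are needed: they become \<open>\<partial>\<^sub>i\<close> and the \<open>q\<close>-derivative.
\<close>

lemma polyexp_peel:
  assumes q0: "\<And>i. q i \<noteq> 0" and "f \<in> polyexp q"
  shows "\<exists>g\<in>polyexp q. \<exists>h\<in>polyexp q. \<forall>m. f m - f (Poly_Mapping.update i c m) =
    (of_nat (Poly_Mapping.lookup m i) - of_nat c) * g m +
    (q i ^ Poly_Mapping.lookup m i - q i ^ c) * h m"
  using assms(2)
proof induction
  case (const a)
  show ?case by (intro bexI[OF _ polyexp.const[of 0]]) simp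
next
  case (coord j)
  show ?case
    by (intro bexI[OF _ polyexp.const[of "if j = i then 1 else 0"]] bexI[OF _ polyexp.const[of 0]])
       (auto simp: lookup_update)
next
  case (expn j)
  show ?case
    by (intro bexI[OF _ polyexp.const[of "if j = i then 1 else 0"]] bexI[OF _ polyexp.const[of 0]])
       (auto simp: lookup_update)
next
  case (expn_inv j)
  have "(\<lambda>m. (if j = i then - (inverse (q i) ^ c) else 0) * inverse (q i) ^ Poly_Mapping.lookup m i)
      \<in> polyexp q" by (intro polyexp_scale polyexp.expn_inv)
  then show ?case using q0[of i]
    by (intro bexI[OF _ polyexp.const[of 0]] bexI) (auto simp: lookup_update field_simps)
next
  case (add f f')
  then obtain g h g' h' where *: "g \<in> polyexp q" "h \<in> polyexp q" "g' \<in> polyexp q" "h' \<in> polyexp q"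
    and f: "\<And>m. f m - f (Poly_Mapping.update i c m) =
      (of_nat (Poly_Mapping.lookup m i) - of_nat c) * g m + (q i ^ Poly_Mapping.lookup m i - q i ^ c) * h m"
    and f': "\<And>m. f' m - f' (Poly_Mapping.update i c m) =
      (of_nat (Poly_Mapping.lookup m i) - of_nat c) * g' m + (q i ^ Poly_Mapping.lookup m i - q i ^ c) * h' m"
    by metis
  have "f m + f' m - (f (Poly_Mapping.update i c m) + f' (Poly_Mapping.update i c m)) =
    (of_nat (Poly_Mapping.lookup m i) - of_nat c) * (g m + g' m) +
    (q i ^ Poly_Mapping.lookup m i - q i ^ c) * (h m + h' m)" for m
    unfolding add_diff_add f f' by (simp add: algebra_simps)
  with * show ?case by (intro bexI[OF _ polyexp.add[of g _ g']] bexI[OF _ polyexp.add[of h _ h']]) auto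
next
  case (mult f f')
  then obtain g h g' h' where *: "g \<in> polyexp q" "h \<in> polyexp q" "g' \<in> polyexp q" "h' \<in> polyexp q"
    and f: "\<And>m. f m - f (Poly_Mapping.update i c m) =
      (of_nat (Poly_Mapping.lookup m i) - of_nat c) * g m + (q i ^ Poly_Mapping.lookup m i - q i ^ c) * h m"
    and f': "\<And>m. f' m - f' (Poly_Mapping.update i c m) =
      (of_nat (Poly_Mapping.lookup m i) - of_nat c) * g' m + (q i ^ Poly_Mapping.lookup m i - q i ^ c) * h' m"
    by metis
  define G where "G m = g m * f' m + f (Poly_Mapping.update i c m) * g' m" for m
  define H where "H m = h m * f' m + f (Poly_Mapping.update i c m) * h' m" for m
  have GH: "G \<in> polyexp q" "H \<in> polyexp q" unfolding G_def[abs_def] H_def[abs_def]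
    using * mult.hyps by (auto intro!: polyexp.add polyexp.mult polyexp_update)
  have "f m * f' m - f (Poly_Mapping.update i c m) * f' (Poly_Mapping.update i c m) =
    (f m - f (Poly_Mapping.update i c m)) * f' m +
    f (Poly_Mapping.update i c m) * (f' m - f' (Poly_Mapping.update i c m))" for m
    by (simp add: algebra_simps)
  also have "\<dots> m = (of_nat (Poly_Mapping.lookup m i) - of_nat c) * G m +
    (q i ^ Poly_Mapping.lookup m i - q i ^ c) * H m" for m
    unfolding f f' G_def H_def by (simp add: algebra_simps)
  finally show ?case using GH by blast
qed

text \<open>
  The monomials that a shift of degree \<open>d\<close> keeps inside the polynomial ring.
\<close>

definition shiftable :: "('n \<Rightarrow> int) \<Rightarrow> 'n expo \<Rightarrow> bool"
  where "shiftable d m \<longleftrightarrow> (\<forall>i. 0 \<le> monom_deg m i + d i)"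

definition shift :: "('n::finite \<Rightarrow> int) \<Rightarrow> 'n expo \<Rightarrow> 'n expo"
  where "shift d m = Poly_Mapping.Abs_poly_mapping (\<lambda>i. nat (monom_deg m i + d i))"

text \<open>
  An operator of degree \<open>d\<close> must kill every monomial that it would move out of the ring. On
  such a weight function the truncation to natural numbers in \<open>shift\<close> has no effect.
\<close>

definition supported :: "('n \<Rightarrow> int) \<Rightarrow> ('n expo \<Rightarrow> 'k::zero) \<Rightarrow> bool"
  where "supported d F \<longleftrightarrow> (\<forall>m. \<not> shiftable d m \<longrightarrow> F m = 0)"

abbreviation unit_deg :: "'n \<Rightarrow> 'n \<Rightarrow> int"
  where "unit_deg i \<equiv> monom_deg (Poly_Mapping.single i 1)"

lemma unit_deg_apply: "unit_deg i j = (if j = i then 1 else 0)"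
  by (simp add: monom_deg_def lookup_single when_def)

lemma monom_deg_add: "monom_deg (m + k) i = monom_deg m i + monom_deg k i"
  by (simp add: monom_deg_def lookup_add)

text \<open>
  The hypothesis \<open>d\<^sub>i = - c - 1\<close> makes \<open>F\<close> vanish at \<open>m\<^sub>i = 0, \<dots>, c\<close>. Splitting off a factor
  that vanishes at \<open>m\<^sub>i = c\<close> has to leave the zeros at \<open>m\<^sub>i < c\<close> and those in the other coordinates
  untouched. Let \<open>U\<close> be the binomial coefficient of \<open>m\<^sub>i\<close> over \<open>c\<close>, which is zero for \<open>m\<^sub>i < c\<close> and
  one at \<open>c\<close>, and write \<open>F = F U + F (1 - U)\<close>. In the first summand the root at \<open>c\<close> is split off
  \<open>F\<close> and \<open>U\<close> keeps the lower zeros; in the second it is split off \<open>1 - U\<close> and \<open>F\<close> keeps all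
  its zeros. The zeros of \<open>F\<close> in the other coordinates survive in the first summand because
  \<open>F = \<Sum> u(m\<^sub>i) v\<close>, where the \<open>v\<close> share these zeros, and only the \<open>u\<close> are divided.
\<close>

lemma polyexp_split_root:
  fixes q :: "'n::finite \<Rightarrow> 'k::field_char_0"
  assumes q0: "\<And>i. q i \<noteq> 0" and F: "F \<in> polyexp q" "supported d F"
    and di: "d i = - int c - 1"
  shows "\<exists>G\<in>polyexp q. \<exists>H\<in>polyexp q.
    supported (\<lambda>j. d j + unit_deg i j) G \<and> supported (\<lambda>j. d j + unit_deg i j) H \<and>
    (\<forall>m. F m = (of_nat (Poly_Mapping.lookup m i) - of_nat c) * G m +
               (q i ^ Poly_Mapping.lookup m i - q i ^ c) * H m)"
proof -
  \<comment> \<open>\<open>V\<close> records the zeros forced by the coordinates other than \<open>i\<close>. They do not depend on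
    \<open>m\<^sub>i\<close>, so all restrictions of \<open>F\<close> to a fixed value of \<open>m\<^sub>i\<close> lie in \<open>V\<close>.\<close>
  define V where "V = {v \<in> polyexp q. \<forall>m. (\<exists>j. j \<noteq> i \<and> monom_deg m j + d j < 0) \<longrightarrow> v m = 0}"
  define W where "W = {w. (\<lambda>m. w (Poly_Mapping.lookup m i)) \<in> polyexp q}"
  have V_add: "(\<lambda>m. v m + v' m) \<in> V" if "v \<in> V" "v' \<in> V" for v v'
    using that by (auto simp: V_def intro: polyexp.add)
  have V_mult: "(\<lambda>m. f m * v m) \<in> V" if "f \<in> polyexp q" "v \<in> V" for f v
    using that by (auto simp: V_def intro: polyexp.mult)
  have FV: "(\<lambda>m. F (Poly_Mapping.update i n m)) \<in> V" for n
  proof -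
    have "F (Poly_Mapping.update i n m) = 0" if "j \<noteq> i" "monom_deg m j + d j < 0" for j m
    proof -
      have "monom_deg (Poly_Mapping.update i n m) j + d j < 0"
        using that by (simp add: monom_deg_def lookup_update)
      then show ?thesis using F(2) by (metis supported_def shiftable_def not_le)
    qed
    then show ?thesis using polyexp_update[OF F(1)] by (auto simp: V_def)
  qed
  obtain us where us: "set us \<subseteq> W \<times> V"
    and F_us: "\<And>n m. F (Poly_Mapping.update i n m) = (\<Sum>(u,v)\<leftarrow>us. u n * v m)"
  proof -
    from separated_sum_list[OF polyexp_separated[OF q0 F(1)], of i] obtain ws where
      ws: "\<forall>(w,h)\<in>set ws. (\<lambda>m. w (Poly_Mapping.lookup m i)) \<in> polyexp q"
      "\<And>n m. F (Poly_Mapping.update i n m) = (\<Sum>(w,h)\<leftarrow>ws. w n * h m)" by blast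
    have "\<exists>us. set us \<subseteq> W \<times> V \<and>
        (\<forall>n m. F (Poly_Mapping.update i n m) = (\<Sum>(u,v)\<leftarrow>us. u n * v m))"
    proof (rule rank_reduction[where F = "\<lambda>n m. F (Poly_Mapping.update i n m)" and ws = ws])
      show "(\<lambda>m. v m - c * v' m) \<in> V" if "v \<in> V" "v' \<in> V" for c v v'
        using V_add[OF that(1) V_mult[OF polyexp.const[of "-c"] that(2)]] by simp
    qed (use ws FV in \<open>auto simp: W_def intro: polyexp_diff polyexp_scale\<close>)
    with that show thesis by blast
  qed
  have "\<exists>G\<in>V. \<exists>H\<in>V. \<forall>m. (\<Sum>(u,v)\<leftarrow>us. (u (Poly_Mapping.lookup m i) - u c) * v m) =
      (of_nat (Poly_Mapping.lookup m i) - of_nat c) * G m +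
      (q i ^ Poly_Mapping.lookup m i - q i ^ c) * H m"
    using us
  proof (induction us)
    case Nil
    have "(\<lambda>_. 0) \<in> V" by (auto simp: V_def intro: polyexp.const)
    then show ?case by (intro bexI) auto
  next
    case (Cons uv us)
    obtain u v where uv: "uv = (u,v)" by force
    have u: "(\<lambda>m. u (Poly_Mapping.lookup m i)) \<in> polyexp q" and v: "v \<in> V"
      using Cons.prems by (auto simp: uv W_def)
    from polyexp_peel[OF q0 u, of i c] obtain g h where gh: "g \<in> polyexp q" "h \<in> polyexp q"
      and *: "\<And>m. u (Poly_Mapping.lookup m i) - u c =
        (of_nat (Poly_Mapping.lookup m i) - of_nat c) * g m + (q i ^ Poly_Mapping.lookup m i - q i ^ c) * h m"
      by (auto simp: lookup_update)
    from Cons.IH Cons.prems obtain G H where GH: "G \<in> V" "H \<in> V"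
      and **: "\<And>m. (\<Sum>(u,v)\<leftarrow>us. (u (Poly_Mapping.lookup m i) - u c) * v m) =
      (of_nat (Poly_Mapping.lookup m i) - of_nat c) * G m +
      (q i ^ Poly_Mapping.lookup m i - q i ^ c) * H m" by auto
    have "(\<Sum>(u,v)\<leftarrow>uv # us. (u (Poly_Mapping.lookup m i) - u c) * v m) =
      (of_nat (Poly_Mapping.lookup m i) - of_nat c) * (g m * v m + G m) +
      (q i ^ Poly_Mapping.lookup m i - q i ^ c) * (h m * v m + H m)" for m
      by (simp only: uv list.map sum_list.Cons prod.case * **) (simp add: algebra_simps)
    then show ?case
      by (intro bexI[OF _ V_add[OF V_mult[OF gh(1) v] GH(1)]]
          bexI[OF _ V_add[OF V_mult[OF gh(2) v] GH(2)]] allI)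
  qed
  then obtain G0 H0 where GH0: "G0 \<in> V" "H0 \<in> V"
    and us_GH: "\<And>m. (\<Sum>(u,v)\<leftarrow>us. (u (Poly_Mapping.lookup m i) - u c) * v m) =
      (of_nat (Poly_Mapping.lookup m i) - of_nat c) * G0 m +
      (q i ^ Poly_Mapping.lookup m i - q i ^ c) * H0 m" by blast
  \<comment> \<open>Since \<open>\<Sum> u(c) v\<close> is the restriction of \<open>F\<close> to \<open>m\<^sub>i = c\<close>, which vanishes, each \<open>u\<close> may
    be replaced by \<open>u - u(c)\<close>.\<close>
  have F_GH0: "F m = (of_nat (Poly_Mapping.lookup m i) - of_nat c) * G0 m +
      (q i ^ Poly_Mapping.lookup m i - q i ^ c) * H0 m" for m
  proof -
    have "\<not> shiftable d (Poly_Mapping.update i c m)"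
      using di unfolding shiftable_def monom_deg_def by (auto simp: lookup_update intro!: exI[of _ i])
    then have "F (Poly_Mapping.update i c m) = 0" using F(2) by (auto simp: supported_def)
    moreover have "F m = F (Poly_Mapping.update i (Poly_Mapping.lookup m i) m)" by simp
    ultimately have "F m = (\<Sum>(u,v)\<leftarrow>us. u (Poly_Mapping.lookup m i) * v m) - (\<Sum>(u,v)\<leftarrow>us. u c * v m)"
      unfolding F_us by simp
    also have "\<dots> = (\<Sum>(u,v)\<leftarrow>us. (u (Poly_Mapping.lookup m i) - u c) * v m)"
      by (induction us) (auto simp: algebra_simps)
    finally show ?thesis by (simp add: us_GH)
  qed
  define U where "U m = (1 / fact c) * (\<Prod>j<c. of_nat (Poly_Mapping.lookup m i) - of_nat j :: 'k)" for m
  have U: "U \<in> polyexp q" unfolding U_def[abs_def]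
    by (intro polyexp_scale polyexp_prod polyexp_diff polyexp.coord polyexp.const)
  have U0: "U m = 0" if "Poly_Mapping.lookup m i < c" for m
    using that by (auto simp: U_def)
  have U1: "U (Poly_Mapping.update i c m) = 1" for m
  proof -
    have "(\<Prod>j<c. of_nat c - of_nat j :: 'k) = (\<Prod>j<c. of_nat (c - j))"
      by (intro prod.cong) (auto simp: of_nat_diff)
    also have "\<dots> = of_nat (\<Prod>j<c. c - j)" by simp
    also have "(\<Prod>j<c. c - j) = fact c"
      by (simp add: fact_prod_rev lessThan_atLeast0)
    finally show ?thesis by (simp add: U_def lookup_update)
  qed
  from polyexp_peel[OF q0 U, of i c] obtain g h where gh: "g \<in> polyexp q" "h \<in> polyexp q"
    and U_gh: "\<And>m. U m - 1 = (of_nat (Poly_Mapping.lookup m i) - of_nat c) * g m +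
      (q i ^ Poly_Mapping.lookup m i - q i ^ c) * h m"
    unfolding U1 by blast
  define G where "G m = G0 m * U m - F m * g m" for m
  define H where "H m = H0 m * U m - F m * h m" for m
  have FG: "F m = (of_nat (Poly_Mapping.lookup m i) - of_nat c) * G m +
               (q i ^ Poly_Mapping.lookup m i - q i ^ c) * H m" for m
  proof -
    have "(of_nat (Poly_Mapping.lookup m i) - of_nat c) * G m +
        (q i ^ Poly_Mapping.lookup m i - q i ^ c) * H m =
      ((of_nat (Poly_Mapping.lookup m i) - of_nat c) * G0 m +
        (q i ^ Poly_Mapping.lookup m i - q i ^ c) * H0 m) * U m - F m * (U m - 1)"
      unfolding U_gh unfolding G_def H_def by (simp add: algebra_simps)
    also have "\<dots> = F m" unfolding F_GH0[symmetric] by (simp add: algebra_simps)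
    finally show ?thesis ..
  qed
  have supp: "supported (\<lambda>j. d j + unit_deg i j) (\<lambda>m. K0 m * U m - F m * k m)" if "K0 \<in> V" for K0 k
    unfolding supported_def
  proof (intro allI impI)
    fix m assume "\<not> shiftable (\<lambda>j. d j + unit_deg i j) m"
    then obtain j where j: "monom_deg m j + d j + unit_deg i j < 0"
      by (auto simp: shiftable_def not_le add.assoc)
    then have "monom_deg m j + d j < 0" unfolding unit_deg_apply by (simp split: if_splits)
    then have "F m = 0" using F(2) by (metis supported_def shiftable_def not_le)
    moreover have "K0 m * U m = 0"
    proof (cases "j = i")
      case True
      with j di have "U m = 0" unfolding unit_deg_apply by (intro U0) (simp add: monom_deg_def)
      then show ?thesis by simp
    next
      case False
      then have "K0 m = 0" using that \<open>monom_deg m j + d j < 0\<close> by (auto simp: V_def)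
      then show ?thesis by simp
    qed
    ultimately show "K0 m * U m - F m * k m = 0" by simp
  qed
  have "G \<in> polyexp q" "H \<in> polyexp q" unfolding G_def[abs_def] H_def[abs_def]
    using GH0 U gh F(1) by (auto intro!: polyexp_diff polyexp.mult simp: V_def)
  moreover have "supported (\<lambda>j. d j + unit_deg i j) G" "supported (\<lambda>j. d j + unit_deg i j) H"
    unfolding G_def[abs_def] H_def[abs_def] using supp GH0 by blast+
  ultimately show ?thesis using FG by (intro bexI[of _ G] bexI[of _ H] conjI allI)
qed

section \<open>Weighted shift operators\<close>

lemma monom_deg_inj: "monom_deg m = monom_deg m' \<longleftrightarrow> m = m'"
  by (auto simp: monom_deg_def fun_eq_iff intro!: poly_mapping_eqI)

lemma monom_deg_shift:
  assumes "shiftable d m" shows "monom_deg (shift d m) = (\<lambda>i. monom_deg m i + d i)"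
  using assms unfolding shift_def monom_deg_def shiftable_def
  by (subst Abs_poly_mapping_inverse) auto

lemma shift_eqI:
  assumes "monom_deg m' = (\<lambda>i. monom_deg m i + d i)"
  shows "shiftable d m" "shift d m = m'"
proof -
  have "0 \<le> monom_deg m' i" for i by (simp add: monom_deg_def)
  then show "shiftable d m" unfolding shiftable_def by (simp add: assms)
  then have "monom_deg (shift d m) = monom_deg m'" by (simp add: monom_deg_shift assms)
  then show "shift d m = m'" by (simp add: monom_deg_inj)
qed

lemma shift_shift:
  assumes "shiftable d m"
  shows "shiftable e (shift d m) \<longleftrightarrow> shiftable (\<lambda>i. d i + e i) m"
    and "shiftable (\<lambda>i. d i + e i) m \<Longrightarrow> shift e (shift d m) = shift (\<lambda>i. d i + e i) m"
proof -
  show 1: "shiftable e (shift d m) \<longleftrightarrow> shiftable (\<lambda>i. d i + e i) m"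
    unfolding shiftable_def monom_deg_shift[OF assms] by (simp add: add.assoc)
  show "shift e (shift d m) = shift (\<lambda>i. d i + e i) m" if "shiftable (\<lambda>i. d i + e i) m"
    using that 1 by (intro shift_eqI(2)) (simp add: monom_deg_shift assms add.assoc)
qed

lemma shift_inject:
  assumes "shiftable d m" "shiftable e m" "shift d m = shift e m" shows "d = e"
proof -
  have "monom_deg (shift d m) = monom_deg (shift e m)" using assms(3) by simp
  then show ?thesis using assms(1,2) by (simp add: monom_deg_shift fun_eq_iff)
qed

lemma shiftable_monom_deg [simp]: "shiftable (monom_deg k) m"
  by (simp add: shiftable_def monom_deg_def)

lemma shift_monom_deg [simp]: "shift (monom_deg k) m = m + k"
  by (intro shift_eqI(2)) (auto simp: monom_deg_add)

lemma shiftable_0 [simp]: "shiftable (\<lambda>_. 0) m"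
  by (simp add: shiftable_def monom_deg_def)

lemma shift_0 [simp]: "shift (\<lambda>_. 0) m = m"
  by (intro shift_eqI(2)) simp

lemma supported_monom_deg [simp]: "supported (monom_deg k) F"
  by (simp add: supported_def)

lemma supported_0 [simp]: "supported (\<lambda>_. 0) F"
  by (simp add: supported_def)

text \<open>
  Every homogeneous operator has this form (lemma \<open>homogeneous_eq_wshift\<close>), so that questions
  about such operators become questions about the weight \<open>F\<close>.
\<close>

definition wshift :: "('n::finite \<Rightarrow> int) \<Rightarrow> ('n expo \<Rightarrow> 'k::field) \<Rightarrow> ('n, 'k) oper"
  where "wshift d F = lin_ext (\<lambda>m. Poly_Mapping.single (shift d m) (F m))"

lemma pscale_single [simp]: "pscale c (Poly_Mapping.single m a) = Poly_Mapping.single m (c * a)"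
  by (simp add: pscale_def mult_single)

lemma pscale_pscale [simp]: "pscale a (pscale b p) = pscale (a * b) p"
  by (auto intro!: poly_mapping_eqI)

lemma pscale_add_left: "pscale (a + b) p = pscale a p + pscale b p"
  by (auto intro!: poly_mapping_eqI simp: lookup_add algebra_simps)

lemma pscale_one [simp]: "pscale 1 p = p"
  by (auto intro!: poly_mapping_eqI)

lemma lin_ext_single [simp]: "lin_ext f (Poly_Mapping.single m c) = pscale c (f m)"
  by (simp add: lin_ext_def)

lemma lin_ext_in_endos: "lin_ext f \<in> endos"
proof -
  have *: "lin_ext f p = (\<Sum>m\<in>S. pscale (Poly_Mapping.lookup p m) (f m))"
    if "finite S" "Poly_Mapping.keys p \<subseteq> S" for S p
    unfolding lin_ext_def using that by (intro sum.mono_neutral_left) (auto simp: in_keys_iff)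
  have "lin_ext f (p + r) = lin_ext f p + lin_ext f r" for p r
    by (subst (1 2 3) *[where S = "Poly_Mapping.keys p \<union> Poly_Mapping.keys r"])
       (use keys_add[of p r] in \<open>auto simp: lookup_add pscale_add_left sum.distrib\<close>)
  moreover have "lin_ext f (pscale c p) = pscale c (lin_ext f p)" for c p
    by (subst (1 2) *[where S = "Poly_Mapping.keys p"]) (auto simp: pscale_sum in_keys_iff)
  ultimately show ?thesis by (simp add: endos_iff)
qed

lemma endos_eqI:
  assumes "\<phi> \<in> endos" "\<psi> \<in> endos"
    and "\<And>m. \<phi> (Poly_Mapping.single m 1) = \<psi> (Poly_Mapping.single m 1)"
  shows "\<phi> = \<psi>"
  by (subst (1 2) lin_ext_endo[symmetric]) (simp_all only: assms)

lemma endos_comp: "\<phi> \<in> endos \<Longrightarrow> \<psi> \<in> endos \<Longrightarrow> \<phi> \<circ> \<psi> \<in> endos"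
  by (simp add: endos_iff)

lemma endos_add: "\<phi> \<in> endos \<Longrightarrow> \<psi> \<in> endos \<Longrightarrow> (\<lambda>p. \<phi> p + \<psi> p) \<in> endos"
  by (simp add: endos_iff pscale_add algebra_simps)

lemma endos_pscale: "\<phi> \<in> endos \<Longrightarrow> (\<lambda>p. pscale c (\<phi> p)) \<in> endos"
  by (simp add: endos_iff pscale_add mult.commute)

lemma grHom_subset_endos: "(grHom :: ('n, 'k::field) oper set) \<subseteq> endos"
proof
  fix \<phi> :: "('n, 'k::field) oper" assume "\<phi> \<in> grHom"
  then obtain D :: "('n \<Rightarrow> int) set" and \<psi> where "\<forall>d\<in>D. \<psi> d \<in> endos" and \<phi>: "\<phi> = (\<lambda>p. \<Sum>d\<in>D. \<psi> d p)"
    unfolding grHom_def homogeneous_def by blast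
  then show "\<phi> \<in> endos"
    unfolding \<phi> by (auto simp: endos_iff sum.distrib pscale_sum)
qed

lemma mult_oper_endos: "mult_oper r \<in> endos"
  using mult_oper_grHom grHom_subset_endos by blast

lemma wshift_in_endos: "wshift d F \<in> endos"
  unfolding wshift_def by (rule lin_ext_in_endos)

lemma wshift_single [simp]:
  "wshift d F (Poly_Mapping.single m c) = Poly_Mapping.single (shift d m) (c * F m)"
  by (simp add: wshift_def)

lemma homogeneousI:
  assumes "\<phi> \<in> endos"
    and "\<And>m. \<phi> (Poly_Mapping.single m 1) \<in> graded_part (\<lambda>i. monom_deg m i + d i)"
  shows "homogeneous d \<phi>"
proof -
  have "\<phi> p \<in> graded_part (\<lambda>i. b i + d i)" if "p \<in> graded_part b" for b p
  proof -
    have "\<phi> p = lin_ext (\<lambda>m. \<phi> (Poly_Mapping.single m 1)) p"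
      using lin_ext_endo[OF assms(1)] by simp
    moreover have "pscale (Poly_Mapping.lookup p m) (\<phi> (Poly_Mapping.single m 1))
        \<in> graded_part (\<lambda>i. b i + d i)" if "m \<in> Poly_Mapping.keys p" for m
    proof -
      have "b = monom_deg m" using that \<open>p \<in> graded_part b\<close> by (simp add: graded_part_def)
      then show ?thesis using assms(2)[of m] by (auto simp: graded_part_def in_keys_iff)
    qed
    then have "(\<Sum>m\<in>A. pscale (Poly_Mapping.lookup p m) (\<phi> (Poly_Mapping.single m 1)))
        \<in> graded_part (\<lambda>i. b i + d i)" if "A \<subseteq> Poly_Mapping.keys p" for A
      using that by (induction A rule: infinite_finite_induct) (auto intro: graded_part_0 graded_part_add)
    ultimately show ?thesis by (simp add: lin_ext_def)
  qed
  then show ?thesis using assms(1) by (auto simp: homogeneous_def)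
qed

lemma wshift_homogeneous:
  assumes "supported d F" shows "homogeneous d (wshift d F)"
proof (rule homogeneousI[OF wshift_in_endos])
  fix m
  show "wshift d F (Poly_Mapping.single m 1) \<in> graded_part (\<lambda>i. monom_deg m i + d i)"
  proof (cases "shiftable d m")
    case True
    then show ?thesis
      using single_in_graded_part[of "shift d m" "F m"] by (simp add: monom_deg_shift)
  next
    case False
    then show ?thesis using assms by (simp add: supported_def graded_part_0)
  qed
qed

lemma wshift_add: "(\<lambda>p. wshift d F p + wshift d G p) = wshift d (\<lambda>m. F m + G m)"
  by (rule endos_eqI) (auto intro!: endos_add wshift_in_endos simp: single_add)

lemma wshift_scale: "(\<lambda>p. pscale c (wshift d F p)) = wshift d (\<lambda>m. c * F m)"
  by (rule endos_eqI) (auto intro!: endos_pscale wshift_in_endos)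

text \<open>
  The product weight is taken as a parameter \<open>H\<close>, since its natural formula is only meaningful
  where the inner shift is defined.
\<close>

lemma wshift_comp:
  assumes "supported d F" "supported e G"
    and "\<And>m. shiftable d m \<Longrightarrow> H m = G (shift d m) * F m"
    and "\<And>m. \<not> shiftable d m \<Longrightarrow> H m = 0"
  shows "wshift e G \<circ> wshift d F = wshift (\<lambda>i. d i + e i) H"
proof (rule endos_eqI)
  fix m
  show "(wshift e G \<circ> wshift d F) (Poly_Mapping.single m 1) =
      wshift (\<lambda>i. d i + e i) H (Poly_Mapping.single m 1)"
  proof (cases "shiftable d m")
    case True
    show ?thesis
    proof (cases "shiftable (\<lambda>i. d i + e i) m")
      case True
      then show ?thesis using \<open>shiftable d m\<close> by (simp add: shift_shift(2) assms(3) mult.commute)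
    next
      case False
      then have "G (shift d m) = 0" using shift_shift(1)[OF True] assms(2) by (auto simp: supported_def)
      then show ?thesis using True by (simp add: assms(3))
    qed
  next
    case False
    then show ?thesis using assms(1,4) by (simp add: supported_def endos_0[OF wshift_in_endos])
  qed
qed (intro endos_comp wshift_in_endos)+

lemma mult_oper_single: "mult_oper (Poly_Mapping.single k c) = wshift (monom_deg k) (\<lambda>_. c)"
  by (rule endos_eqI[OF mult_oper_endos wshift_in_endos])
     (simp add: mult_oper_def mult_single add.commute)

lemma id_wshift: "id = wshift (\<lambda>_. 0) (\<lambda>_. 1)"
proof (rule endos_eqI)
  show "id \<in> endos" by (simp add: endos_iff)
qed (simp_all add: wshift_in_endos)

lemma shift_minus_unit:
  assumes "Poly_Mapping.lookup m i \<noteq> 0"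
  shows "shiftable (\<lambda>j. - unit_deg i j) m" "shift (\<lambda>j. - unit_deg i j) m = m - Poly_Mapping.single i 1"
proof -
  have "monom_deg (m - Poly_Mapping.single i 1) = (\<lambda>j. monom_deg m j + - unit_deg i j)"
    using assms by (auto simp: monom_deg_def lookup_minus lookup_single when_def fun_eq_iff)
  from shift_eqI[OF this] show "shiftable (\<lambda>j. - unit_deg i j) m"
    "shift (\<lambda>j. - unit_deg i j) m = m - Poly_Mapping.single i 1" .
qed

lemma supported_minus_unit:
  fixes F :: "'n::finite expo \<Rightarrow> 'k::zero"
  assumes "\<And>m. Poly_Mapping.lookup m i = 0 \<Longrightarrow> F m = 0"
  shows "supported (\<lambda>j. - unit_deg i j) F"
  unfolding supported_def
proof (intro allI impI)
  fix m :: "'n expo" assume "\<not> shiftable (\<lambda>j. - unit_deg i j) m"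
  then have "Poly_Mapping.lookup m i = 0" using shift_minus_unit(1)[of m i] by (rule contrapos_np)
  then show "F m = 0" by (rule assms)
qed

text \<open>
  The truncated subtraction of \<open>e\<^sub>i\<close> agrees with the shift by \<open>- e\<^sub>i\<close> wherever the weight is not
  zero.
\<close>

lemma lowering_eq_wshift:
  assumes "\<And>m. Poly_Mapping.lookup m i = 0 \<Longrightarrow> F m = 0"
  shows "lin_ext (\<lambda>m. Poly_Mapping.single (m - Poly_Mapping.single i 1) (F m)) =
    wshift (\<lambda>j. - unit_deg i j) F"
proof (rule endos_eqI[OF lin_ext_in_endos wshift_in_endos])
  fix m
  show "lin_ext (\<lambda>m. Poly_Mapping.single (m - Poly_Mapping.single i 1) (F m)) (Poly_Mapping.single m 1) =
      wshift (\<lambda>j. - unit_deg i j) F (Poly_Mapping.single m 1)"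
  proof (cases "Poly_Mapping.lookup m i = 0")
    case True
    then have "F m = 0" by (rule assms)
    then show ?thesis by simp
  next
    case False
    then show ?thesis by (simp only: lin_ext_single wshift_single shift_minus_unit(2)[OF False] pscale_single mult_1 mult_1_right)
  qed
qed

lemma partial_eq_wshift:
  "partial i = wshift (\<lambda>j. - unit_deg i j) (\<lambda>m. of_nat (Poly_Mapping.lookup m i))"
  unfolding partial_def
  by (rule lowering_eq_wshift[of i "\<lambda>m. of_nat (Poly_Mapping.lookup m i)"]) (simp only: of_nat_0)

text \<open>
  The \<open>q\<close>-integer of \<open>m\<^sub>i\<close> in base \<open>q\<^sub>i\<^sup>k\<close>, normalized by \<open>q\<^sub>i - 1\<close> for every \<open>k\<close>.
\<close>

definition q_bracket :: "('n \<Rightarrow> 'k::field) \<Rightarrow> int \<Rightarrow> 'n \<Rightarrow> 'n expo \<Rightarrow> 'k"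
  where "q_bracket q k i m = (q i powi (k * int (Poly_Mapping.lookup m i)) - 1) / (q i - 1)"

lemma q_partial_eq_wshift:
  "q_partial q k i = wshift (\<lambda>j. - unit_deg i j) (q_bracket q k i)"
proof -
  have "q_partial q k i =
      lin_ext (\<lambda>m. Poly_Mapping.single (m - Poly_Mapping.single i 1) (q_bracket q k i m))"
    by (simp only: q_partial_def q_bracket_def)
  also have "\<dots> = wshift (\<lambda>j. - unit_deg i j) (q_bracket q k i)"
    by (rule lowering_eq_wshift[of i "q_bracket q k i"]) (simp add: q_bracket_def)
  finally show ?thesis .
qed

text \<open>
  Recovers the weight of the degree \<open>d\<close> component, with value zero where \<open>m + d\<close> is not an
  exponent vector; this makes it a supported weight.
\<close>

definition coeff_fun :: "('n::finite \<Rightarrow> int) \<Rightarrow> ('n, 'k::field) oper \<Rightarrow> 'n expo \<Rightarrow> 'k"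
  where "coeff_fun d \<phi> m =
    (if shiftable d m then Poly_Mapping.lookup (\<phi> (Poly_Mapping.single m 1)) (shift d m) else 0)"

lemma coeff_fun_supported: "supported d (coeff_fun d \<phi>)"
  by (simp add: supported_def coeff_fun_def)

lemma coeff_fun_add: "coeff_fun d (\<lambda>p. \<phi> p + \<psi> p) = (\<lambda>m. coeff_fun d \<phi> m + coeff_fun d \<psi> m)"
  by (auto simp: coeff_fun_def lookup_add)

lemma coeff_fun_wshift:
  assumes "supported e F" shows "coeff_fun d (wshift e F) = (if d = e then F else (\<lambda>_. 0))"
proof
  fix m
  show "coeff_fun d (wshift e F) m = (if d = e then F else (\<lambda>_. 0)) m"
  proof (cases "shiftable d m \<and> shiftable e m")
    case True
    then have "shift e m = shift d m \<longleftrightarrow> d = e" using shift_inject[of e m d] by metis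
    then show ?thesis using True by (simp add: coeff_fun_def lookup_single when_def)
  next
    case False
    then show ?thesis using assms by (auto simp: coeff_fun_def supported_def)
  qed
qed

lemma homogeneous_eq_wshift:
  assumes "homogeneous d \<phi>" shows "\<phi> = wshift d (coeff_fun d \<phi>)"
proof (rule endos_eqI)
  show "\<phi> \<in> endos" using assms by (simp add: homogeneous_def)
  fix m
  have *: "\<phi> (Poly_Mapping.single m 1) \<in> graded_part (\<lambda>i. monom_deg m i + d i)"
    using assms single_in_graded_part unfolding homogeneous_def by blast
  have "Poly_Mapping.lookup (\<phi> (Poly_Mapping.single m 1)) l =
      (coeff_fun d \<phi> m when shift d m = l)" for l
  proof (cases "monom_deg l = (\<lambda>i. monom_deg m i + d i)")
    case True
    from shift_eqI[OF this] show ?thesis by (simp add: coeff_fun_def)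
  next
    case False
    then have "l \<notin> Poly_Mapping.keys (\<phi> (Poly_Mapping.single m 1))"
      using * by (auto simp: graded_part_def)
    moreover have "coeff_fun d \<phi> m = 0" if "shift d m = l"
      using that False monom_deg_shift[of d m] by (auto simp: coeff_fun_def)
    ultimately show ?thesis by (auto simp: in_keys_iff when_def)
  qed
  then show "\<phi> (Poly_Mapping.single m 1) = wshift d (coeff_fun d \<phi>) (Poly_Mapping.single m 1)"
    by (auto intro!: poly_mapping_eqI simp: lookup_single)
qed (rule wshift_in_endos)

section \<open>Twisted commutators with multiplications\<close>

lemma mpoly_additive_induct [case_names zero single add]:
  fixes P :: "('n, 'k::field) mpoly \<Rightarrow> bool"
  assumes "P 0" "\<And>k c. P (Poly_Mapping.single k c)" "\<And>r s. P r \<Longrightarrow> P s \<Longrightarrow> P (r + s)"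
  shows "P r"
proof -
  have "P (\<Sum>m\<in>A. Poly_Mapping.single m (Poly_Mapping.lookup r m))" for A
    by (induction A rule: infinite_finite_induct) (auto intro: assms)
  from this[of "Poly_Mapping.keys r"] show ?thesis using sum_monoms[of r] by simp
qed

lemma bichar_add_left:
  assumes "\<And>i. q i \<noteq> 0"
  shows "bichar q (\<lambda>i. a i + b i) d = bichar q a d * bichar q b d"
  using assms by (simp add: bichar_def prod.distrib[symmetric] distrib_right power_int_add)

lemma bichar_0_left [simp]: "bichar q (\<lambda>_. 0) d = 1"
  by (simp add: bichar_def)

lemma bichar_unit:
  fixes q :: "'n::finite \<Rightarrow> 'k::field"
  shows "bichar q a (unit_deg i) = q i powi a i"
proof -
  have "bichar q a (unit_deg i) = (\<Prod>j\<in>UNIV. if j = i then q i powi a i else 1)"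
    unfolding bichar_def unit_deg_apply by (rule prod.cong) auto
  then show ?thesis by simp
qed

text \<open>
  The automorphism by which a degree vector \<open>a\<close> acts on polynomials; twisting a multiplication
  operator amounts to applying it to the multiplier.
\<close>

definition torus :: "('n::finite \<Rightarrow> 'k::field) \<Rightarrow> ('n \<Rightarrow> int) \<Rightarrow> ('n, 'k) oper"
  where "torus q a = wshift (\<lambda>_. 0) (\<lambda>m. bichar q a (monom_deg m))"

lemma lookup_wshift_0:
  "Poly_Mapping.lookup (wshift (\<lambda>_. 0) F r) m = F m * Poly_Mapping.lookup r m"
  by (auto simp: wshift_def lin_ext_def lookup_sum lookup_single when_def in_keys_iff
      sum.delta if_distrib cong: if_cong)

lemma torus_add: "torus q a (r + s) = torus q a r + torus q a s"
  and torus_0 [simp]: "torus q a 0 = 0"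
  and torus_single [simp]:
    "torus q a (Poly_Mapping.single m c) = Poly_Mapping.single m (c * bichar q a (monom_deg m))"
  using wshift_in_endos[of "\<lambda>_. 0" "\<lambda>m. bichar q a (monom_deg m)", unfolded endos_iff]
    endos_0[OF wshift_in_endos] unfolding torus_def by simp_all

lemma torus_torus:
  assumes "\<And>i. q i \<noteq> 0" shows "torus q a (torus q b r) = torus q (\<lambda>i. a i + b i) r"
  by (rule poly_mapping_eqI) (simp add: torus_def lookup_wshift_0 bichar_add_left assms)

lemma twist_mult_oper: "twist q a (mult_oper r) = mult_oper (torus q a r)"
proof -
  define D where "D = monom_deg ` Poly_Mapping.keys r"
  have D: "finite D" by (simp add: D_def)
  have hom: "homogeneous d (mult_oper (proj d r))" if "d \<in> D" for d
  proof -
    from that obtain m where d: "d = monom_deg m" unfolding D_def by auto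
    have "proj d r = Poly_Mapping.single m (Poly_Mapping.lookup r m)"
      by (rule poly_mapping_eqI) (simp add: d lookup_proj lookup_single monom_deg_inj when_def)
    then show ?thesis using mult_monom_homogeneous by (simp add: d)
  qed
  have r: "r = (\<Sum>d\<in>D. proj d r)"
    by (rule poly_mapping_eqI) (auto simp: lookup_sum lookup_proj D D_def in_keys_iff)
  have tr: "torus q a r = (\<Sum>d\<in>D. pscale (bichar q a d) (proj d r))"
    by (rule poly_mapping_eqI)
       (auto simp: torus_def lookup_wshift_0 lookup_sum lookup_proj D D_def in_keys_iff
          if_distrib cong: if_cong)
  have "mult_oper r = (\<lambda>p. \<Sum>d\<in>D. mult_oper (proj d r) p)"
    unfolding mult_oper_def by (subst r) (simp add: sum_distrib_right fun_eq_iff)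
  then have "twist q a (mult_oper r) = (\<lambda>p. \<Sum>d\<in>D. pscale (bichar q a d) (mult_oper (proj d r) p))"
    using twist_sum_homogeneous[OF D hom] by simp
  also have "\<dots> = mult_oper (torus q a r)"
    unfolding tr mult_oper_def sum_distrib_right pscale_def by (simp add: mult.assoc)
  finally show ?thesis .
qed

lemma mult_pscale: "r * pscale c p = pscale c (r * p)"
  by (simp add: pscale_def mult.left_commute)

lemma pscale_diff: "pscale c (p - r) = pscale c p - pscale c r"
  by (simp add: pscale_def right_diff_distrib)

lemma bracket_mult_oper:
  "bracket q a \<phi> (mult_oper r) = (\<lambda>p. \<phi> (r * p) - torus q a r * \<phi> p)"
  unfolding bracket_def twist_mult_oper by (simp add: mult_oper_def)

text \<open>
  Commuting past \<open>x\<^sup>k\<close> acts on weights as a twisted difference operator. This translates the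
  inductive definition of \<open>q\<close>-differential operators into difference equations.
\<close>

lemma bracket_wshift_single:
  assumes "supported d F"
  shows "bracket q a (wshift d F) (mult_oper (Poly_Mapping.single k c)) =
    wshift (\<lambda>i. monom_deg k i + d i)
      (\<lambda>m. c * (F (m + k) - bichar q a (monom_deg k) * F m))"
    (is "?L = wshift ?e ?G")
proof (rule endos_eqI)
  show "?L \<in> endos"
    using wshift_in_endos[of d F]
    unfolding bracket_mult_oper by (simp add: endos_iff mult_pscale pscale_diff distrib_left)
  fix m
  have 1: "Poly_Mapping.single (shift d (k + m)) x = Poly_Mapping.single (shift ?e m) x"
    if "x = 0 \<or> F (m + k) \<noteq> 0" for x
  proof (cases "x = 0")
    case False
    with that assms have "shiftable d (shift (monom_deg k) m)" by (auto simp: supported_def)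
    with shift_shift[of "monom_deg k" m d] have "shift d (m + k) = shift ?e m" by simp
    then show ?thesis by (simp add: add.commute)
  qed simp
  have 2: "Poly_Mapping.single (k + shift d m) x = Poly_Mapping.single (shift ?e m) x"
    if "x = 0 \<or> F m \<noteq> 0" for x
  proof (cases "x = 0")
    case False
    with that assms have d: "shiftable d m" by (auto simp: supported_def)
    have "?e = (\<lambda>i. d i + monom_deg k i)" by (simp add: add.commute)
    with shift_shift[OF d, of "monom_deg k"] have "shift d m + k = shift ?e m" by simp
    then show ?thesis by (simp add: add.commute)
  qed simp
  have "?L (Poly_Mapping.single m 1) = Poly_Mapping.single (shift d (k + m)) (c * F (m + k)) -
      Poly_Mapping.single (k + shift d m) (c * bichar q a (monom_deg k) * F m)"
    unfolding bracket_mult_oper by (simp add: mult_single add.commute)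
  also have "\<dots> = Poly_Mapping.single (shift ?e m) (c * F (m + k)) -
      Poly_Mapping.single (shift ?e m) (c * bichar q a (monom_deg k) * F m)"
    by (subst 1, force, subst 2) auto
  finally show "?L (Poly_Mapping.single m 1) = wshift ?e ?G (Poly_Mapping.single m 1)"
    by (simp add: single_diff[symmetric] algebra_simps)
qed (rule wshift_in_endos)

lemma supported_bracket:
  assumes "supported d F"
  shows "supported (\<lambda>i. monom_deg k i + d i)
      (\<lambda>m. c * (F (m + k) - bichar q a (monom_deg k) * F m))"
  unfolding supported_def
proof (intro allI impI)
  fix m assume *: "\<not> shiftable (\<lambda>i. monom_deg k i + d i) m"
  then have "\<not> shiftable d (m + k)" by (simp add: shiftable_def monom_deg_add add.assoc)
  moreover have "\<not> shiftable d m"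
  proof -
    obtain i where "monom_deg m i + (monom_deg k i + d i) < 0"
      using * by (auto simp: shiftable_def not_le)
    moreover have "0 \<le> monom_deg k i" by (simp add: monom_deg_def)
    ultimately have "\<not> 0 \<le> monom_deg m i + d i" by linarith
    then show ?thesis unfolding shiftable_def by blast
  qed
  ultimately show "c * (F (m + k) - bichar q a (monom_deg k) * F m) = 0"
    using assms by (simp add: supported_def)
qed

lemma bracket_add_right:
  assumes "\<phi> \<in> endos"
  shows "bracket q a \<phi> (mult_oper (r + s)) =
    (\<lambda>p. bracket q a \<phi> (mult_oper r) p + bracket q a \<phi> (mult_oper s) p)"
  using assms unfolding bracket_mult_oper by (simp add: endos_iff torus_add algebra_simps)

lemma bracket_0_right:
  assumes "\<phi> \<in> endos" shows "bracket q a \<phi> (mult_oper 0) = (\<lambda>_. 0)"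
  using assms unfolding bracket_mult_oper by (simp add: endos_0)

text \<open>
  A Leibniz rule: both terms on the right involve one bracket of lower order, which is why
  orders add up under composition.
\<close>

lemma bracket_comp:
  fixes q :: "'n::finite \<Rightarrow> 'k::field"
  assumes "\<And>i. q i \<noteq> 0" "\<phi> \<in> endos"
  shows "bracket q (\<lambda>i. a i + b i) (\<phi> \<circ> \<psi>) (mult_oper r) =
    (\<lambda>p. (\<phi> \<circ> bracket q b \<psi> (mult_oper r)) p +
         (bracket q a \<phi> (mult_oper (torus q b r)) \<circ> \<psi>) p)"
proof -
  have diff: "\<phi> (x - y) = \<phi> x - \<phi> y" for x y
    using assms(2) by (metis endos_iff add_diff_cancel diff_add_cancel)
  show ?thesis unfolding bracket_mult_oper by (simp add: diff torus_torus assms(1))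
qed

section \<open>Multiplicativity of the order filtration\<close>

lemma sub_bimodule_hull:
  assumes "S \<subseteq> grHom" shows "sub_bimodule (sub_bimodule hull S)"
proof -
  have "sub_bimodule hull S \<subseteq> grHom" using assms sub_bimodule_grHom by (rule hull_minimal)
  then show ?thesis unfolding sub_bimodule_def[of "sub_bimodule hull S"]
    by (intro conjI ballI allI) (auto simp: hull_def sub_bimodule_def)
qed

text \<open>
  The filtration step that brackets have to lie in. The zero module in front of step \<open>0\<close> makes
  the base case an instance of the general step.
\<close>

definition Dq_prev :: "('n::finite \<Rightarrow> 'k::field) \<Rightarrow> nat \<Rightarrow> ('n, 'k) oper set"
  where "Dq_prev q m = (case m of 0 \<Rightarrow> {\<lambda>_. 0} | Suc l \<Rightarrow> Dq_filt q l)"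

definition Dq_gens :: "('n::finite \<Rightarrow> 'k::field) \<Rightarrow> nat \<Rightarrow> ('n, 'k) oper set"
  where "Dq_gens q m = {\<phi>. (\<exists>d. homogeneous d \<phi>) \<and>
    (\<exists>a. \<forall>r. bracket q a \<phi> (mult_oper r) \<in> Dq_prev q m)}"

lemma Dq_filt_eq_hull: "Dq_filt q m = sub_bimodule hull (Dq_gens q m)"
  by (cases m) (simp_all add: Dq_gens_def Dq_prev_def)

lemma Dq_gens_grHom: "Dq_gens q m \<subseteq> grHom"
  by (auto simp: Dq_gens_def intro: homogeneous_imp_grHom)

lemma sub_bimodule_Dq_filt: "sub_bimodule (Dq_filt q m)"
  unfolding Dq_filt_eq_hull by (rule sub_bimodule_hull[OF Dq_gens_grHom])

lemma sub_bimoduleD: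
  assumes "sub_bimodule B"
  shows "\<phi> \<in> B \<Longrightarrow> \<phi> \<in> grHom" "(\<lambda>_. 0) \<in> B"
    "\<phi> \<in> B \<Longrightarrow> \<psi> \<in> B \<Longrightarrow> (\<lambda>p. \<phi> p + \<psi> p) \<in> B"
    "\<phi> \<in> B \<Longrightarrow> mult_oper r \<circ> \<phi> \<in> B" "\<phi> \<in> B \<Longrightarrow> \<phi> \<circ> mult_oper r \<in> B"
  using assms unfolding sub_bimodule_def by blast+

lemma sub_bimodule_zero: "sub_bimodule {\<lambda>_. 0}"
  by (auto simp: sub_bimodule_def mult_oper_def homogeneous_imp_grHom[OF zero_homogeneous])

lemma sub_bimodule_Dq_prev: "sub_bimodule (Dq_prev q m)"
  by (cases m) (simp_all add: Dq_prev_def sub_bimodule_zero sub_bimodule_Dq_filt)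

lemma Dq_prev_subset: "Dq_prev q m \<subseteq> Dq_filt q m"
proof (induction m)
  case 0
  show ?case using sub_bimoduleD(2)[OF sub_bimodule_Dq_filt, of q 0]
    by (simp add: Dq_prev_def del: Dq_filt.simps)
next
  case (Suc m)
  then have "Dq_gens q m \<subseteq> Dq_gens q (Suc m)"
    unfolding Dq_gens_def by (auto simp: Dq_prev_def[of q "Suc m"])
  then show ?case unfolding Dq_prev_def Dq_filt_eq_hull by (simp add: hull_mono)
qed

lemma Dq_filt_mono: "m \<le> l \<Longrightarrow> Dq_filt q m \<subseteq> Dq_filt q l"
  by (rule lift_Suc_mono_le[of "Dq_filt q"]) (use Dq_prev_subset[of q "Suc _"] in \<open>simp_all add: Dq_prev_def\<close>)

lemma Dq_gens_subset_filt: "Dq_gens q m \<subseteq> Dq_filt q m"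
  unfolding Dq_filt_eq_hull by (rule hull_subset)

lemma Dq_gens_mult_single:
  assumes "\<phi> \<in> Dq_gens q m"
  shows "\<phi> \<circ> mult_oper (Poly_Mapping.single k c) \<in> Dq_gens q m"
proof -
  from assms obtain d a where d: "homogeneous d \<phi>"
    and a: "\<And>r. bracket q a \<phi> (mult_oper r) \<in> Dq_prev q m" by (auto simp: Dq_gens_def)
  have "bracket q a (\<phi> \<circ> mult_oper (Poly_Mapping.single k c)) (mult_oper r) =
      bracket q a \<phi> (mult_oper r) \<circ> mult_oper (Poly_Mapping.single k c)" for r
    unfolding bracket_mult_oper by (auto simp: mult_oper_def mult.left_commute)
  then have "bracket q a (\<phi> \<circ> mult_oper (Poly_Mapping.single k c)) (mult_oper r) \<in> Dq_prev q m" for r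
    using sub_bimoduleD(5)[OF sub_bimodule_Dq_prev a] by simp
  then show ?thesis
    using homogeneous_comp[OF d mult_monom_homogeneous] unfolding Dq_gens_def by blast
qed

text \<open>
  The set of operators that compose well with the generators on the left is a sub-bimodule, since
  the generators absorb multiplications by monomials on the right; so it contains the whole
  filtration step. The same argument then applies to the left factor.
\<close>

lemma Dq_filt_comp_of_gens:
  assumes gens: "\<And>\<phi> \<psi>. \<phi> \<in> Dq_gens q m \<Longrightarrow> \<psi> \<in> Dq_gens q l \<Longrightarrow> \<phi> \<circ> \<psi> \<in> Dq_filt q n"
    and "\<phi> \<in> Dq_filt q m" "\<psi> \<in> Dq_filt q l"
  shows "\<phi> \<circ> \<psi> \<in> Dq_filt q n"
proof -
  note B = sub_bimoduleD[OF sub_bimodule_Dq_filt]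
  have endo: "\<phi> \<in> endos" if "\<phi> \<in> Dq_gens q m" for \<phi>
    using that Dq_gens_grHom grHom_subset_endos by blast
  define T where "T = {\<psi> \<in> grHom. \<forall>\<phi>\<in>Dq_gens q m. \<phi> \<circ> \<psi> \<in> Dq_filt q n}"
  have "sub_bimodule T"
    unfolding sub_bimodule_def
  proof (intro conjI ballI allI)
    show "T \<subseteq> grHom" by (auto simp: T_def)
    show "(\<lambda>_. 0) \<in> T"
      by (auto simp: T_def comp_def endos_0 endo B(2) homogeneous_imp_grHom[OF zero_homogeneous])
    show "(\<lambda>p. \<psi> p + \<psi>' p) \<in> T" if "\<psi> \<in> T" "\<psi>' \<in> T" for \<psi> \<psi>'
    proof -
      have "\<phi> \<circ> (\<lambda>p. \<psi> p + \<psi>' p) = (\<lambda>p. (\<phi> \<circ> \<psi>) p + (\<phi> \<circ> \<psi>') p)" if "\<phi> \<in> Dq_gens q m" for \<phi>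
        using endo[OF that] by (auto simp: endos_iff)
      then show ?thesis using that unfolding T_def by (auto intro: grHom_add B(3) simp del: comp_apply)
    qed
    fix r \<psi> assume \<psi>: "\<psi> \<in> T"
    have "\<phi> \<circ> (mult_oper r \<circ> \<psi>) \<in> Dq_filt q n" if \<phi>: "\<phi> \<in> Dq_gens q m" for \<phi>
    proof (induction r rule: mpoly_additive_induct)
      case zero
      have "\<phi> \<circ> (mult_oper 0 \<circ> \<psi>) = (\<lambda>_. 0)"
        using endos_0[OF endo[OF \<phi>]] by (auto simp: mult_oper_def)
      then show ?case using B(2) by metis
    next
      case (single k c)
      have "(\<phi> \<circ> mult_oper (Poly_Mapping.single k c)) \<circ> \<psi> \<in> Dq_filt q n"
        using \<psi> Dq_gens_mult_single[OF \<phi>, of k c] unfolding T_def by blast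
      then show ?case by (simp only: comp_assoc)
    next
      case (add r s)
      have "\<phi> \<circ> (mult_oper (r + s) \<circ> \<psi>) =
          (\<lambda>p. (\<phi> \<circ> (mult_oper r \<circ> \<psi>)) p + (\<phi> \<circ> (mult_oper s \<circ> \<psi>)) p)"
        using endo[OF \<phi>] by (auto simp: endos_iff mult_oper_def distrib_right)
      then show ?case using B(3)[OF add] by (simp only:)
    qed
    then show "mult_oper r \<circ> \<psi> \<in> T"
      using \<psi> by (auto simp: T_def intro: grHom_comp mult_oper_grHom)
    have "\<phi> \<circ> (\<psi> \<circ> mult_oper r) \<in> Dq_filt q n" if "\<phi> \<in> Dq_gens q m" for \<phi>
      unfolding comp_assoc[symmetric] using \<psi> that unfolding T_def by (intro B(5)) blast
    then show "\<psi> \<circ> mult_oper r \<in> T"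
      using \<psi> by (auto simp: T_def intro: grHom_comp mult_oper_grHom)
  qed
  moreover have "Dq_gens q l \<subseteq> T" using gens Dq_gens_grHom[of q l] by (auto simp: T_def)
  ultimately have T: "Dq_filt q l \<subseteq> T" unfolding Dq_filt_eq_hull[of q l] by (simp add: hull_minimal)
  define U where "U = {\<phi> \<in> grHom. \<forall>\<psi>\<in>Dq_filt q l. \<phi> \<circ> \<psi> \<in> Dq_filt q n}"
  have "sub_bimodule U"
    unfolding sub_bimodule_def
  proof (intro conjI ballI allI)
    show "U \<subseteq> grHom" by (auto simp: U_def)
    show "(\<lambda>_. 0) \<in> U"
      by (auto simp: U_def comp_def B(2) homogeneous_imp_grHom[OF zero_homogeneous])
    show "(\<lambda>p. \<phi> p + \<phi>' p) \<in> U" if "\<phi> \<in> U" "\<phi>' \<in> U" for \<phi> \<phi>'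
    proof -
      have "(\<lambda>p. \<phi> p + \<phi>' p) \<circ> \<psi> = (\<lambda>p. (\<phi> \<circ> \<psi>) p + (\<phi>' \<circ> \<psi>) p)" for \<psi> :: "('a, 'b) oper"
        by auto
      then show ?thesis using that unfolding U_def by (auto intro: grHom_add B(3) simp del: comp_apply)
    qed
    fix r \<phi> assume \<phi>: "\<phi> \<in> U"
    have "(mult_oper r \<circ> \<phi>) \<circ> \<psi> \<in> Dq_filt q n" "(\<phi> \<circ> mult_oper r) \<circ> \<psi> \<in> Dq_filt q n"
      if "\<psi> \<in> Dq_filt q l" for \<psi>
      unfolding comp_assoc using \<phi> B(4) that unfolding U_def by blast+
    then show "mult_oper r \<circ> \<phi> \<in> U" "\<phi> \<circ> mult_oper r \<in> U"
      using \<phi> by (auto simp: U_def intro: grHom_comp mult_oper_grHom)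
  qed
  moreover have "Dq_gens q m \<subseteq> U" using T Dq_gens_grHom[of q m] by (auto simp: U_def T_def)
  ultimately have "Dq_filt q m \<subseteq> U" unfolding Dq_filt_eq_hull[of q m] by (simp add: hull_minimal)
  then show ?thesis using assms(2,3) by (auto simp: U_def)
qed

text \<open>
  By the Leibniz rule, the bracket of a composition of generators is a sum of two compositions
  of total order \<open>m + l - 1\<close>, so induction on \<open>m + l\<close> applies.
\<close>

lemma Dq_filt_comp:
  fixes q :: "'n::finite \<Rightarrow> 'k::field"
  assumes q0: "\<And>i. q i \<noteq> 0"
  shows "\<phi> \<in> Dq_filt q m \<Longrightarrow> \<psi> \<in> Dq_filt q l \<Longrightarrow> \<phi> \<circ> \<psi> \<in> Dq_filt q (m + l)"
proof (induction "m + l" arbitrary: m l \<phi> \<psi> rule: less_induct)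
  case less
  have "\<phi> \<circ> \<psi> \<in> Dq_filt q (m + l)" if \<phi>: "\<phi> \<in> Dq_gens q m" and \<psi>: "\<psi> \<in> Dq_gens q l" for \<phi> \<psi>
  proof -
    from \<phi> obtain d a where d: "homogeneous d \<phi>"
      and a: "\<And>r. bracket q a \<phi> (mult_oper r) \<in> Dq_prev q m" by (auto simp: Dq_gens_def)
    from \<psi> obtain e b where e: "homogeneous e \<psi>"
      and b: "\<And>r. bracket q b \<psi> (mult_oper r) \<in> Dq_prev q l" by (auto simp: Dq_gens_def)
    have \<phi>_endo: "\<phi> \<in> endos" using d by (simp add: homogeneous_def)
    note Z = sub_bimoduleD(2)[OF sub_bimodule_Dq_prev]
    have 1: "\<phi> \<circ> \<chi> \<in> Dq_prev q (m + l)" if \<chi>: "\<chi> \<in> Dq_prev q l" for \<chi>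
    proof (cases l)
      case 0
      then have "\<phi> \<circ> \<chi> = (\<lambda>_. 0)" using \<chi> endos_0[OF \<phi>_endo] by (auto simp: Dq_prev_def)
      then show ?thesis by (simp add: Z)
    next
      case (Suc l')
      with less.hyps[of m l' \<phi> \<chi>] \<phi> \<chi> Dq_gens_subset_filt show ?thesis by (auto simp: Dq_prev_def)
    qed
    have 2: "\<chi> \<circ> \<psi> \<in> Dq_prev q (m + l)" if \<chi>: "\<chi> \<in> Dq_prev q m" for \<chi>
    proof (cases m)
      case 0
      then have "\<chi> \<circ> \<psi> = (\<lambda>_. 0)" using \<chi> by (auto simp: Dq_prev_def)
      then show ?thesis by (simp add: Z)
    next
      case (Suc m')
      with less.hyps[of m' l \<chi> \<psi>] \<psi> \<chi> Dq_gens_subset_filt show ?thesis by (auto simp: Dq_prev_def)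
    qed
    have "bracket q (\<lambda>i. a i + b i) (\<phi> \<circ> \<psi>) (mult_oper r) \<in> Dq_prev q (m + l)" for r
      unfolding bracket_comp[OF q0 \<phi>_endo] by (rule sub_bimoduleD(3)[OF sub_bimodule_Dq_prev 1[OF b] 2[OF a]])
    then have "\<phi> \<circ> \<psi> \<in> Dq_gens q (m + l)"
      unfolding Dq_gens_def using homogeneous_comp[OF d e] by blast
    then show ?thesis using Dq_gens_subset_filt by blast
  qed
  then show ?case using less.prems by (rule Dq_filt_comp_of_gens)
qed

section \<open>Operators with exponential polynomial coefficients\<close>

text \<open>
  This turns out to be the ring \<open>D\<^sub>q\<close> itself; unlike the filtration, it is cut out by one
  condition on weights.
\<close>

inductive_set polyexp_opers :: "('n::finite \<Rightarrow> 'k::field_char_0) \<Rightarrow> ('n, 'k) oper set" for q where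
  wshift: "F \<in> polyexp q \<Longrightarrow> supported d F \<Longrightarrow> wshift d F \<in> polyexp_opers q"
| add: "\<phi> \<in> polyexp_opers q \<Longrightarrow> \<psi> \<in> polyexp_opers q \<Longrightarrow> (\<lambda>p. \<phi> p + \<psi> p) \<in> polyexp_opers q"

lemma polyexp_opers_zero: "(\<lambda>_. 0) \<in> polyexp_opers q"
proof -
  have "wshift (\<lambda>_. 0) (\<lambda>_. 0) = (\<lambda>_. 0 :: ('a, 'b) mpoly)"
    by (auto simp: wshift_def lin_ext_def)
  moreover have "wshift (\<lambda>_. 0) (\<lambda>_. 0) \<in> polyexp_opers q"
    by (intro polyexp_opers.wshift polyexp.const supported_0)
  ultimately show ?thesis by metis
qed

lemma polyexp_opers_grHom: "polyexp_opers q \<subseteq> grHom"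
proof
  fix \<phi> assume "\<phi> \<in> polyexp_opers q"
  then show "\<phi> \<in> grHom"
    by induction (auto intro: grHom_add homogeneous_imp_grHom wshift_homogeneous)
qed

lemma coeff_fun_polyexp_opers:
  assumes "\<phi> \<in> polyexp_opers q" shows "coeff_fun d \<phi> \<in> polyexp q"
  using assms
  by induction (auto simp: coeff_fun_wshift coeff_fun_add intro: polyexp.const polyexp.add)

lemma mult_single_wshift:
  assumes "supported d F"
  shows "mult_oper (Poly_Mapping.single k c) \<circ> wshift d F =
    wshift (\<lambda>i. d i + monom_deg k i) (\<lambda>m. c * F m)"
  unfolding mult_oper_single
  using assms by (intro wshift_comp) (auto simp: supported_def)

lemma wshift_mult_single:
  assumes "supported d F"
  shows "wshift d F \<circ> mult_oper (Poly_Mapping.single k c) =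
    wshift (\<lambda>i. monom_deg k i + d i) (\<lambda>m. F (m + k) * c)"
  unfolding mult_oper_single
  using assms by (intro wshift_comp) (auto simp: supported_def)

lemma supported_raise:
  fixes F :: "'n expo \<Rightarrow> 'k::field"
  assumes "supported d F"
  shows "supported (\<lambda>i. d i + monom_deg k i) (\<lambda>m. c * F m)"
    and "supported (\<lambda>i. monom_deg k i + d i) (\<lambda>m. F (m + k) * c)"
proof -
  show "supported (\<lambda>i. d i + monom_deg k i) (\<lambda>m. c * F m)"
    unfolding supported_def
  proof (intro allI impI)
    fix m assume "\<not> shiftable (\<lambda>i. d i + monom_deg k i) m"
    then obtain i where "monom_deg m i + (d i + monom_deg k i) < 0"
      by (auto simp: shiftable_def not_le)
    moreover have "0 \<le> monom_deg k i" by (simp add: monom_deg_def)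
    ultimately have "\<not> 0 \<le> monom_deg m i + d i" by linarith
    then have "\<not> shiftable d m" unfolding shiftable_def by blast
    then show "c * F m = 0" using assms by (simp add: supported_def)
  qed
  show "supported (\<lambda>i. monom_deg k i + d i) (\<lambda>m. F (m + k) * c)"
    using assms by (simp add: supported_def shiftable_def monom_deg_add add.assoc)
qed

lemma sub_bimodule_polyexp_opers: "sub_bimodule (polyexp_opers q)"
  unfolding sub_bimodule_def
proof (intro conjI ballI allI)
  show "polyexp_opers q \<subseteq> grHom" by (rule polyexp_opers_grHom)
  show "(\<lambda>_. 0) \<in> polyexp_opers q" by (rule polyexp_opers_zero)
  show "(\<lambda>p. \<phi> p + \<psi> p) \<in> polyexp_opers q" if "\<phi> \<in> polyexp_opers q" "\<psi> \<in> polyexp_opers q" for \<phi> \<psi>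
    using that by (rule polyexp_opers.add)
  fix r \<phi> assume \<phi>: "\<phi> \<in> polyexp_opers q"
  have endo: "\<phi> \<in> endos" using \<phi> polyexp_opers_grHom grHom_subset_endos by blast
  show "mult_oper r \<circ> \<phi> \<in> polyexp_opers q"
  proof (induction r rule: mpoly_additive_induct)
    case zero
    have "mult_oper 0 \<circ> \<phi> = (\<lambda>_. 0)" by (auto simp: mult_oper_def)
    then show ?case using polyexp_opers_zero by metis
  next
    case (single k c)
    from \<phi> show ?case
    proof induction
      case (wshift F d)
      then show ?case unfolding mult_single_wshift[OF wshift(2)]
        by (intro polyexp_opers.wshift polyexp_scale supported_raise)
    next
      case (add \<phi> \<psi>)
      have "mult_oper (Poly_Mapping.single k c) \<circ> (\<lambda>p. \<phi> p + \<psi> p) =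
          (\<lambda>p. (mult_oper (Poly_Mapping.single k c) \<circ> \<phi>) p + (mult_oper (Poly_Mapping.single k c) \<circ> \<psi>) p)"
        by (auto simp: mult_oper_def distrib_left)
      then show ?case using polyexp_opers.add[OF add.IH] by metis
    qed
  next
    case (add r s)
    have "mult_oper (r + s) \<circ> \<phi> = (\<lambda>p. (mult_oper r \<circ> \<phi>) p + (mult_oper s \<circ> \<phi>) p)"
      by (auto simp: mult_oper_def distrib_right)
    then show ?case using polyexp_opers.add[OF add] by metis
  qed
  show "\<phi> \<circ> mult_oper r \<in> polyexp_opers q"
  proof (induction r rule: mpoly_additive_induct)
    case zero
    have "\<phi> \<circ> mult_oper 0 = (\<lambda>_. 0)" using endos_0[OF endo] by (auto simp: mult_oper_def)
    then show ?case using polyexp_opers_zero by metis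
  next
    case (single k c)
    from \<phi> show ?case
    proof induction
      case (wshift F d)
      have "(\<lambda>m. F (m + k) * c) \<in> polyexp q"
        using wshift(1) by (intro polyexp.mult polyexp.const polyexp_translate)
      then show ?case unfolding wshift_mult_single[OF wshift(2)]
        by (intro polyexp_opers.wshift supported_raise wshift(2))
    next
      case (add \<phi> \<psi>)
      have "(\<lambda>p. \<phi> p + \<psi> p) \<circ> mult_oper (Poly_Mapping.single k c) =
          (\<lambda>p. (\<phi> \<circ> mult_oper (Poly_Mapping.single k c)) p + (\<psi> \<circ> mult_oper (Poly_Mapping.single k c)) p)"
        by auto
      then show ?case using polyexp_opers.add[OF add.IH] by metis
    qed
  next
    case (add r s)
    have "\<phi> \<circ> mult_oper (r + s) = (\<lambda>p. (\<phi> \<circ> mult_oper r) p + (\<phi> \<circ> mult_oper s) p)"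
      using endo by (auto simp: endos_iff mult_oper_def distrib_right)
    then show ?case using polyexp_opers.add[OF add] by metis
  qed
qed

text \<open>
  The brackets with the variables \<open>x\<^sub>i\<close> alone suffice. Their weights are the twisted differences
  \<open>f(m + e\<^sub>i) - q\<^sub>i\<^bsup>a\<^sub>i\<^esup> f(m)\<close> of the weight \<open>f\<close> of \<open>\<phi>\<close>, so the difference equations can be
  solved.
\<close>

lemma homogeneous_in_polyexp_opers:
  fixes q :: "'n::finite \<Rightarrow> 'k::field_char_0"
  assumes q0: "\<And>i. q i \<noteq> 0" and inj: "\<And>i a b. a \<noteq> b \<Longrightarrow> q i powi a \<noteq> q i powi b"
    and hom: "homogeneous d \<phi>"
    and bracket: "\<And>r. bracket q a \<phi> (mult_oper r) \<in> polyexp_opers q"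
  shows "\<phi> \<in> polyexp_opers q"
proof -
  define f where "f = coeff_fun d \<phi>"
  have supp: "supported d f" unfolding f_def by (rule coeff_fun_supported)
  have \<phi>: "\<phi> = wshift d f" unfolding f_def by (rule homogeneous_eq_wshift[OF hom])
  have "f \<in> polyexp q"
  proof (rule polyexp_if_differences[where a = a, OF q0 inj])
    fix i
    have "coeff_fun (\<lambda>j. unit_deg i j + d j)
        (bracket q a \<phi> (mult_oper (Poly_Mapping.single (Poly_Mapping.single i 1) 1))) \<in> polyexp q"
      by (rule coeff_fun_polyexp_opers[OF bracket])
    also have "coeff_fun (\<lambda>j. unit_deg i j + d j)
        (bracket q a \<phi> (mult_oper (Poly_Mapping.single (Poly_Mapping.single i 1) 1))) =
        (\<lambda>m. 1 * (f (m + Poly_Mapping.single i 1) - bichar q a (unit_deg i) * f m))"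
      unfolding \<phi> bracket_wshift_single[OF supp]
      by (subst coeff_fun_wshift[OF supported_bracket[OF supp]]) simp
    finally show "(\<lambda>m. f (m + Poly_Mapping.single i 1) - q i powi a i * f m) \<in> polyexp q"
      unfolding bichar_unit by simp
  qed
  then show ?thesis unfolding \<phi> using supp by (rule polyexp_opers.wshift)
qed

lemma Dq_filt_subset_polyexp_opers:
  fixes q :: "'n::finite \<Rightarrow> 'k::field_char_0"
  assumes q0: "\<And>i. q i \<noteq> 0" and inj: "\<And>i a b. a \<noteq> b \<Longrightarrow> q i powi a \<noteq> q i powi b"
  shows "Dq_filt q m \<subseteq> polyexp_opers q"
proof -
  have step: "Dq_filt q m \<subseteq> polyexp_opers q" if "Dq_prev q m \<subseteq> polyexp_opers q" for m
  proof -
    have "Dq_gens q m \<subseteq> polyexp_opers q"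
    proof
      fix \<phi> assume "\<phi> \<in> Dq_gens q m"
      then obtain d a where "homogeneous d \<phi>"
        and "\<And>r. bracket q a \<phi> (mult_oper r) \<in> Dq_prev q m" by (auto simp: Dq_gens_def)
      with that show "\<phi> \<in> polyexp_opers q"
        by (intro homogeneous_in_polyexp_opers[of q d \<phi> a, OF q0 inj]) auto
    qed
    then show ?thesis unfolding Dq_filt_eq_hull using sub_bimodule_polyexp_opers by (rule hull_minimal)
  qed
  show ?thesis
  proof (induction m)
    case 0
    show ?case by (rule step) (simp add: Dq_prev_def polyexp_opers_zero)
  next
    case (Suc m)
    then show ?case by (intro step) (simp add: Dq_prev_def)
  qed
qed

section \<open>Generation by first-order operators\<close>

lemma subalgebra_endos: "subalgebra endos"
  unfolding subalgebra_def
  by (auto intro: endos_add endos_comp endos_pscale) (simp add: endos_iff)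

lemma subalgebra_hull:
  assumes "S \<subseteq> endos" shows "subalgebra (subalgebra hull S)"
proof -
  have "subalgebra hull S \<subseteq> endos" using assms subalgebra_endos by (rule hull_minimal)
  then show ?thesis unfolding subalgebra_def[of "subalgebra hull S"]
    by (intro conjI ballI allI) (auto simp: hull_def subalgebra_def)
qed

lemma subalgebraD:
  assumes "subalgebra A"
  shows "id \<in> A" "\<phi> \<in> A \<Longrightarrow> \<psi> \<in> A \<Longrightarrow> (\<lambda>p. \<phi> p + \<psi> p) \<in> A"
    "\<phi> \<in> A \<Longrightarrow> \<psi> \<in> A \<Longrightarrow> \<phi> \<circ> \<psi> \<in> A" "\<phi> \<in> A \<Longrightarrow> (\<lambda>p. pscale c (\<phi> p)) \<in> A"
  using assms unfolding subalgebra_def by blast+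

lemma q_bracket_supported: "supported (\<lambda>j. - unit_deg i j) (q_bracket q k i)"
  for i :: "'n::finite"
  by (rule supported_minus_unit) (simp add: q_bracket_def)

lemma coord_supported: "supported (\<lambda>j. - unit_deg i j) (\<lambda>m. of_nat (Poly_Mapping.lookup m i) :: 'k::field)"
  for i :: "'n::finite"
  by (rule supported_minus_unit) simp

lemma var_times_lowering:
  assumes "supported (\<lambda>j. - unit_deg i j) F"
  shows "mult_oper (Poly_Mapping.single (Poly_Mapping.single i 1) 1) \<circ> wshift (\<lambda>j. - unit_deg i j) F =
    wshift (\<lambda>_. 0) F"
  using mult_single_wshift[OF assms, of "Poly_Mapping.single i 1" 1] by simp

text \<open>
  The Euler operator \<open>x\<^sub>i \<partial>\<^sub>i\<close> has weight \<open>m\<^sub>i\<close>, and \<open>1 + (q\<^sub>i - 1) x\<^sub>i \<partial>\<^sub>i\<^sup>\<beta>\<close> has weight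
  \<open>q\<^sub>i\<^bsup>m\<^sub>i\<^esup>\<close>; the third kind of derivative gives the inverse. In degree \<open>0\<close> composition multiplies
  weights.
\<close>

lemma diagonal_polyexp_in_subalgebra:
  fixes q :: "'n::finite \<Rightarrow> 'k::field_char_0"
  assumes A: "subalgebra A" and mult: "range mult_oper \<subseteq> A"
    and "\<And>i. partial i \<in> A" "\<And>i. q_partial q 1 i \<in> A" "\<And>i. q_partial q (-1) i \<in> A"
    and q1: "\<And>i. q i \<noteq> 1"
    and "F \<in> polyexp q"
  shows "wshift (\<lambda>_. 0) F \<in> A"
  using assms(7)
proof induction
  case (const c)
  have "wshift (\<lambda>_. 0) (\<lambda>_. c) = (\<lambda>p. pscale c (wshift (\<lambda>_. 0) (\<lambda>_. 1) p))"
    by (simp add: wshift_scale)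
  also have "\<dots> \<in> A" unfolding id_wshift[symmetric] using subalgebraD(1,4)[OF A] by blast
  finally show ?case .
next
  case (coord i)
  have "mult_oper (Poly_Mapping.single (Poly_Mapping.single i 1) 1) \<circ> partial i \<in> A"
    using mult assms(3) subalgebraD(3)[OF A] by blast
  then show ?case unfolding partial_eq_wshift var_times_lowering[OF coord_supported] .
next
  have q_power: "wshift (\<lambda>_. 0) (\<lambda>m. q i powi (k * int (Poly_Mapping.lookup m i))) \<in> A"
    if "q_partial q k i \<in> A" for k i
  proof -
    have "mult_oper (Poly_Mapping.single (Poly_Mapping.single i 1) 1) \<circ> q_partial q k i \<in> A"
      using mult that subalgebraD(3)[OF A] by blast
    then have "wshift (\<lambda>_. 0) (q_bracket q k i) \<in> A"
      unfolding q_partial_eq_wshift var_times_lowering[OF q_bracket_supported] .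
    then have "(\<lambda>p. id p + pscale (q i - 1) (wshift (\<lambda>_. 0) (q_bracket q k i) p)) \<in> A"
      using subalgebraD(1,2,4)[OF A] by blast
    also have "(\<lambda>p. id p + pscale (q i - 1) (wshift (\<lambda>_. 0) (q_bracket q k i) p)) =
        wshift (\<lambda>_. 0) (\<lambda>m. 1 + (q i - 1) * q_bracket q k i m)"
      unfolding id_wshift fun_cong[OF wshift_scale] wshift_add ..
    also have "(\<lambda>m. 1 + (q i - 1) * q_bracket q k i m) =
        (\<lambda>m. q i powi (k * int (Poly_Mapping.lookup m i)))"
      using q1[of i] by (simp add: q_bracket_def)
    finally show ?thesis .
  qed
  {
    case (expn i)
    show ?case using q_power[OF assms(4)] by simp
  next
    case (expn_inv i)
    show ?case using q_power[OF assms(5)] by (simp add: power_int_minus power_inverse)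
  }
next
  case (add f g)
  then show ?case using subalgebraD(2)[OF A add.IH] by (simp add: wshift_add)
next
  case (mult f g)
  have "wshift (\<lambda>_. 0) f \<circ> wshift (\<lambda>_. 0) g = wshift (\<lambda>i. 0 + 0) (\<lambda>m. f m * g m)"
    by (rule wshift_comp) auto
  then show ?case using subalgebraD(3)[OF A mult.IH] by simp
qed

text \<open>
  Induction on the total negativity of \<open>d\<close>. If no entry is negative, the operator is a monomial
  times a diagonal operator. If \<open>d\<^sub>i < 0\<close>, the two factors split off its weight are, up to a
  scalar, the weights of \<open>\<partial>\<^sub>i\<close> and \<open>\<partial>\<^sub>i\<^sup>\<beta>\<close> after a shift by \<open>d + e\<^sub>i\<close>; both derivatives then
  appear as left factors, and the remaining operators have the less negative degree \<open>d + e\<^sub>i\<close>.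
\<close>

lemma polyexp_wshift_in_subalgebra:
  fixes q :: "'n::finite \<Rightarrow> 'k::field_char_0"
  assumes A: "subalgebra A" and mult: "range mult_oper \<subseteq> A"
    and gens: "\<And>i. partial i \<in> A" "\<And>i. q_partial q 1 i \<in> A" "\<And>i. q_partial q (-1) i \<in> A"
    and q1: "\<And>i. q i \<noteq> 1" and q0: "\<And>i. q i \<noteq> 0"
  shows "F \<in> polyexp q \<Longrightarrow> supported d F \<Longrightarrow> wshift d F \<in> A"
proof (induction "\<Sum>i\<in>UNIV. nat (- d i)" arbitrary: d F rule: less_induct)
  case less
  show ?case
  proof (cases "\<forall>i. 0 \<le> d i")
    case True
    define k where "k = shift d (0 :: 'n expo)"
    have "shiftable d 0" using True by (simp add: shiftable_def monom_deg_def)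
    then have k: "monom_deg k = d" by (simp add: k_def monom_deg_shift) (simp add: monom_deg_def)
    have "mult_oper (Poly_Mapping.single k 1) \<circ> wshift (\<lambda>_. 0) F = wshift d F"
      using mult_single_wshift[of "\<lambda>_. 0" F k 1] by (simp add: k)
    moreover have "wshift (\<lambda>_. 0) F \<in> A"
      using A mult gens q1 less.prems(1) by (rule diagonal_polyexp_in_subalgebra)
    ultimately show ?thesis using mult subalgebraD(3)[OF A] by (metis rangeI subsetD)
  next
    case False
    then obtain i where i: "d i < 0" by (auto simp: not_le)
    define c where "c = nat (- d i - 1)"
    have di: "d i = - int c - 1" using i by (simp add: c_def)
    define e where "e j = d j + unit_deg i j" for j
    from polyexp_split_root[OF q0 less.prems di] obtain G H
      where GH: "G \<in> polyexp q" "H \<in> polyexp q" "supported e G" "supported e H"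
      and F: "\<And>m. F m = (of_nat (Poly_Mapping.lookup m i) - of_nat c) * G m +
               (q i ^ Poly_Mapping.lookup m i - q i ^ c) * H m"
      unfolding e_def by blast
    have "(\<Sum>j\<in>UNIV. nat (- e j)) < (\<Sum>j\<in>UNIV. nat (- d j))"
      unfolding e_def unit_deg_apply
    proof (rule sum_strict_mono_ex1)
      show "\<exists>j\<in>UNIV. nat (- (d j + (if j = i then 1 else 0))) < nat (- d j)"
        using i by (intro bexI[of _ i]) auto
    qed auto
    then have IH: "wshift e G \<in> A" "wshift e H \<in> A" using less.hyps GH by blast+
    have e: "(\<lambda>j. e j + - unit_deg i j) = d" by (simp add: e_def)
    have low: "int (Poly_Mapping.lookup (shift e m) i) = int (Poly_Mapping.lookup m i) - int c"
      if "shiftable e m" for m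
      using fun_cong[OF monom_deg_shift[OF that], of i] di
      unfolding e_def unit_deg_apply by (simp add: monom_deg_def)
    have low': "Poly_Mapping.lookup m i = Poly_Mapping.lookup (shift e m) i + c"
      if "shiftable e m" for m using low[OF that] by linarith
    have 1: "partial i \<circ> wshift e G = wshift d (\<lambda>m. (of_nat (Poly_Mapping.lookup m i) - of_nat c) * G m)"
      unfolding partial_eq_wshift e[symmetric]
    proof (rule wshift_comp[OF GH(3) coord_supported])
      fix m
      show "(of_nat (Poly_Mapping.lookup m i) - of_nat c) * G m =
          of_nat (Poly_Mapping.lookup (shift e m) i) * G m" if "shiftable e m"
        by (subst low'[OF that]) simp
      show "(of_nat (Poly_Mapping.lookup m i) - of_nat c) * G m = 0" if "\<not> shiftable e m"
        using GH(3) that by (simp add: supported_def)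
    qed
    \<comment> \<open>After the shift, the \<open>q\<close>-derivative has weight \<open>(q\<^sub>i\<^bsup>m\<^sub>i - c\<^esup> - 1) / (q\<^sub>i - 1)\<close>; the scalar \<open>C\<close>
      turns it into \<open>q\<^sub>i\<^bsup>m\<^sub>i\<^esup> - q\<^sub>i\<^sup>c\<close>.\<close>
    define C where "C = q i ^ c * (q i - 1)"
    have 2: "q_partial q 1 i \<circ> wshift e H =
        wshift d (\<lambda>m. (q i ^ Poly_Mapping.lookup m i - q i ^ c) / C * H m)"
      unfolding q_partial_eq_wshift e[symmetric]
    proof (rule wshift_comp[OF GH(4) q_bracket_supported])
      fix m
      show "(q i ^ Poly_Mapping.lookup m i - q i ^ c) / C * H m =
          q_bracket q 1 i (shift e m) * H m" if "shiftable e m"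
        using q0[of i] q1[of i] unfolding q_bracket_def C_def
        by (subst low'[OF that]) (simp add: power_add field_simps)
      show "(q i ^ Poly_Mapping.lookup m i - q i ^ c) / C * H m = 0" if "\<not> shiftable e m"
        using GH(4) that by (simp add: supported_def)
    qed
    have C: "C \<noteq> 0" using q0[of i] q1[of i] by (simp add: C_def)
    have "wshift d F = (\<lambda>p. (partial i \<circ> wshift e G) p + pscale C ((q_partial q 1 i \<circ> wshift e H) p))"
      unfolding 1 2 fun_cong[OF wshift_scale] wshift_add using C
      by (intro arg_cong[of _ _ "wshift d"] ext) (simp add: F)
    moreover have "partial i \<circ> wshift e G \<in> A" "q_partial q 1 i \<circ> wshift e H \<in> A"
      using subalgebraD(3)[OF A] gens IH by blast+
    ultimately show ?thesis
      using subalgebraD(2)[OF A _ subalgebraD(4)[OF A], of "partial i \<circ> wshift e G" "q_partial q 1 i \<circ> wshift e H" C]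
      by simp
  qed
qed

lemma polyexp_opers_subset_subalgebra:
  fixes q :: "'n::finite \<Rightarrow> 'k::field_char_0"
  assumes A: "subalgebra A" and mult: "range mult_oper \<subseteq> A"
    and gens: "\<And>i. partial i \<in> A" "\<And>i. q_partial q 1 i \<in> A" "\<And>i. q_partial q (-1) i \<in> A"
    and q1: "\<And>i. q i \<noteq> 1" and q0: "\<And>i. q i \<noteq> 0"
  shows "polyexp_opers q \<subseteq> A"
proof
  fix \<phi> assume "\<phi> \<in> polyexp_opers q"
  then show "\<phi> \<in> A"
  proof induction
    case (wshift F d)
    with assms show ?case by (intro polyexp_wshift_in_subalgebra)
  next
    case (add \<phi> \<psi>)
    show ?case by (rule subalgebraD(2)[OF A add.IH])
  qed
qed

section \<open>First-order operators in the filtration\<close>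

lemma Dq_gensI:
  assumes "homogeneous d \<phi>"
    and "\<And>k c. bracket q a \<phi> (mult_oper (Poly_Mapping.single k c)) \<in> Dq_prev q m"
  shows "\<phi> \<in> Dq_gens q m"
proof -
  have endo: "\<phi> \<in> endos" using assms(1) by (simp add: homogeneous_def)
  have "bracket q a \<phi> (mult_oper r) \<in> Dq_prev q m" for r
  proof (induction r rule: mpoly_additive_induct)
    case zero
    show ?case unfolding bracket_0_right[OF endo] by (rule sub_bimoduleD(2)[OF sub_bimodule_Dq_prev])
  next
    case (single k c)
    show ?case by (rule assms(2))
  next
    case (add r s)
    show ?case unfolding bracket_add_right[OF endo]
      by (rule sub_bimoduleD(3)[OF sub_bimodule_Dq_prev add])
  qed
  then show ?thesis using assms(1) by (auto simp: Dq_gens_def)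
qed

text \<open>
  A weight that is multiplicative with character \<open>\<beta>(a, -)\<close> satisfies the homogeneous difference
  equations, so that all brackets vanish.
\<close>

lemma character_in_Dq_filt_0:
  assumes "\<And>m k. s (m + k) = bichar q a (monom_deg k) * s m"
  shows "wshift (\<lambda>_. 0) s \<in> Dq_filt q 0"
proof -
  have "wshift (\<lambda>_. 0) s \<in> Dq_gens q 0"
  proof (rule Dq_gensI)
    show "homogeneous (\<lambda>_. 0) (wshift (\<lambda>_. 0) s)" by (rule wshift_homogeneous) simp
    fix k c
    show "bracket q a (wshift (\<lambda>_. 0) s) (mult_oper (Poly_Mapping.single k c)) \<in> Dq_prev q 0"
      unfolding bracket_wshift_single[OF supported_0] assms
      by (auto simp: Dq_prev_def wshift_def lin_ext_def)
  qed
  then show ?thesis using Dq_gens_subset_filt by blast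
qed

text \<open>
  The hypothesis on \<open>F\<close> says that the operator is a derivation twisted by the diagonal operator
  of weight \<open>s\<close>. Its untwisted commutator with \<open>x\<^sup>k\<close> is therefore that diagonal operator followed
  by a multiplication, which has order \<open>0\<close>. Here \<open>k - e\<^sub>i\<close> is an exponent vector unless
  \<open>k\<^sub>i = 0\<close>, where \<open>F(k) = 0\<close>.
\<close>

lemma twisted_derivation_in_Dq_filt_1:
  fixes q :: "'n::finite \<Rightarrow> 'k::field"
  assumes F: "\<And>m k. F (m + k) = F m + F k * s m"
    and F0: "\<And>m. Poly_Mapping.lookup m i = 0 \<Longrightarrow> F m = 0"
    and s: "wshift (\<lambda>_. 0) s \<in> Dq_filt q 0"
  shows "wshift (\<lambda>j. - unit_deg i j) F \<in> Dq_filt q 1"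
proof -
  have supp: "supported (\<lambda>j. - unit_deg i j) F" using F0 by (rule supported_minus_unit)
  have "wshift (\<lambda>j. - unit_deg i j) F \<in> Dq_gens q 1"
  proof (rule Dq_gensI)
    show "homogeneous (\<lambda>j. - unit_deg i j) (wshift (\<lambda>j. - unit_deg i j) F)"
      using supp by (rule wshift_homogeneous)
    fix k c
    have "bracket q (\<lambda>_. 0) (wshift (\<lambda>j. - unit_deg i j) F) (mult_oper (Poly_Mapping.single k c)) =
        wshift (\<lambda>j. monom_deg k j + - unit_deg i j) (\<lambda>m. c * (F k * s m))"
      unfolding bracket_wshift_single[OF supp] F by simp
    also have "\<dots> \<in> Dq_filt q 0"
    proof (cases "Poly_Mapping.lookup k i = 0")
      case True
      then have "wshift (\<lambda>j. monom_deg k j + - unit_deg i j) (\<lambda>m. c * (F k * s m)) = (\<lambda>_. 0)"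
        by (auto simp: F0 wshift_def lin_ext_def)
      then show ?thesis using sub_bimoduleD(2)[OF sub_bimodule_Dq_filt] by metis
    next
      case False
      define l where "l = k - Poly_Mapping.single i 1"
      have "monom_deg l = (\<lambda>j. monom_deg k j + - unit_deg i j)"
        using False monom_deg_shift[OF shift_minus_unit(1)] shift_minus_unit(2) by (metis l_def)
      then have "wshift (\<lambda>j. monom_deg k j + - unit_deg i j) (\<lambda>m. c * (F k * s m)) =
          mult_oper (Poly_Mapping.single l (c * F k)) \<circ> wshift (\<lambda>_. 0) s"
        using mult_single_wshift[of "\<lambda>_. 0" s l "c * F k"] by (simp add: mult.assoc)
      then show ?thesis using sub_bimoduleD(4)[OF sub_bimodule_Dq_filt s] by metis
    qed
    finally show "bracket q (\<lambda>_. 0) (wshift (\<lambda>j. - unit_deg i j) F)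
        (mult_oper (Poly_Mapping.single k c)) \<in> Dq_prev q 1" by (simp add: Dq_prev_def)
  qed
  then show ?thesis using Dq_gens_subset_filt by blast
qed

lemma id_in_Dq_filt_0: "id \<in> Dq_filt q 0"
proof -
  have "wshift (\<lambda>_. 0) (\<lambda>_. 1) \<in> Dq_filt q 0"
    by (rule character_in_Dq_filt_0[where s = "\<lambda>_. 1" and a = "\<lambda>_. 0"]) simp
  then show ?thesis by (simp only: id_wshift)
qed

lemma mult_oper_in_Dq_filt_0: "mult_oper r \<in> Dq_filt q 0"
  using sub_bimoduleD(4)[OF sub_bimodule_Dq_filt id_in_Dq_filt_0, of r q] by (simp only: comp_id)

lemma partial_in_Dq_filt_1: "partial i \<in> Dq_filt q 1"
  unfolding partial_eq_wshift
  by (rule twisted_derivation_in_Dq_filt_1[where s = "\<lambda>_. 1"])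
     (use id_in_Dq_filt_0 in \<open>auto simp: lookup_add id_wshift\<close>)

lemma q_partial_in_Dq_filt_1:
  fixes q :: "'n::finite \<Rightarrow> 'k::field"
  assumes q0: "\<And>i. q i \<noteq> 0"
  shows "q_partial q k i \<in> Dq_filt q 1"
  unfolding q_partial_eq_wshift
proof (rule twisted_derivation_in_Dq_filt_1[where s = "\<lambda>m. q i powi (k * int (Poly_Mapping.lookup m i))"])
  fix m l :: "'n expo"
  show "q_bracket q k i (m + l) = q_bracket q k i m +
      q_bracket q k i l * q i powi (k * int (Poly_Mapping.lookup m i))"
    using q0[of i] unfolding q_bracket_def
    by (simp add: lookup_add distrib_left power_int_add add_divide_distrib[symmetric] algebra_simps)
  show "q_bracket q k i m = 0" if "Poly_Mapping.lookup m i = 0" using that by (simp add: q_bracket_def)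
  show "wshift (\<lambda>_. 0) (\<lambda>m. q i powi (k * int (Poly_Mapping.lookup m i))) \<in> Dq_filt q 0"
  proof (rule character_in_Dq_filt_0)
    fix m l :: "'n expo"
    have "bichar q (\<lambda>j. k * unit_deg i j) (monom_deg l) =
        (\<Prod>j\<in>UNIV. if j = i then q i powi (k * int (Poly_Mapping.lookup l i)) else 1)"
      unfolding bichar_def unit_deg_apply by (rule prod.cong) (auto simp: monom_deg_def)
    then show "q i powi (k * int (Poly_Mapping.lookup (m + l) i)) =
        bichar q (\<lambda>j. k * unit_deg i j) (monom_deg l) * q i powi (k * int (Poly_Mapping.lookup m i))"
      using q0[of i] by (simp add: lookup_add distrib_left power_int_add)
  qed
qed

lemma Dq_filt_subset_Dq: "\<phi> \<in> Dq_filt q m \<Longrightarrow> \<phi> \<in> Dq q"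
  by (auto simp: Dq_def)

lemma subalgebra_Dq:
  fixes q :: "'n::finite \<Rightarrow> 'k::field"
  assumes q0: "\<And>i. q i \<noteq> 0"
  shows "subalgebra (Dq q)"
  unfolding subalgebra_def
proof (intro conjI ballI allI)
  note B = sub_bimoduleD[OF sub_bimodule_Dq_filt[of q]]
  show "Dq q \<subseteq> endos"
  proof
    fix \<phi> assume "\<phi> \<in> Dq q"
    then obtain m where "\<phi> \<in> Dq_filt q m" by (auto simp: Dq_def)
    then show "\<phi> \<in> endos" using B(1) grHom_subset_endos by blast
  qed
  show "id \<in> Dq q" by (rule Dq_filt_subset_Dq[OF id_in_Dq_filt_0])
  fix \<phi> assume "\<phi> \<in> Dq q"
  then obtain m where \<phi>: "\<phi> \<in> Dq_filt q m" by (auto simp: Dq_def)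
  {
    fix \<psi> assume "\<psi> \<in> Dq q"
    then obtain l where \<psi>: "\<psi> \<in> Dq_filt q l" by (auto simp: Dq_def)
    have "\<phi> \<in> Dq_filt q (max m l)" "\<psi> \<in> Dq_filt q (max m l)"
      using Dq_filt_mono[of m "max m l" q] Dq_filt_mono[of l "max m l" q] \<phi> \<psi> by auto
    then show "(\<lambda>p. \<phi> p + \<psi> p) \<in> Dq q" by (intro Dq_filt_subset_Dq[OF B(3)])
    show "\<phi> \<circ> \<psi> \<in> Dq q" by (rule Dq_filt_subset_Dq[OF Dq_filt_comp[OF q0 \<phi> \<psi>]])
  }
  fix c
  have "(\<lambda>p. pscale c (\<phi> p)) = mult_oper (Poly_Mapping.single 0 c) \<circ> \<phi>"
    by (auto simp: mult_oper_def pscale_def)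
  then show "(\<lambda>p. pscale c (\<phi> p)) \<in> Dq q"
    by (simp only: Dq_filt_subset_Dq[OF B(4)[OF \<phi>]])
qed

section \<open>Transcendence and the generation theorem\<close>

text \<open>
  Two equal powers would make \<open>x\<close> a root of unity.
\<close>

lemma transcendental_powi_inj:
  fixes x :: "'k::field_char_0"
  assumes x: "\<not> algebraic x" and "a \<noteq> b"
  shows "x powi a \<noteq> x powi b"
proof -
  have x0: "x \<noteq> 0" using x by auto
  have "x powi b \<noteq> x powi a" if "a < b" for a b
  proof
    assume "x powi b = x powi a"
    then have "x powi (b - a) = 1" using x0 by (simp add: power_int_diff)
    then have 1: "x ^ nat (b - a) = 1" using that by (simp add: power_int_def)
    have "algebraic x"
    proof (rule algebraicI)
      show "coeff (monom 1 (nat (b - a)) - 1 :: 'k poly) i \<in> \<int>" for i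
        by (auto simp: coeff_1)
      show "poly (monom 1 (nat (b - a)) - 1) x = 0" using 1 by (simp add: poly_monom)
      have "coeff (monom 1 (nat (b - a)) - 1 :: 'k poly) 0 \<noteq> 0" using that by simp
      then show "monom 1 (nat (b - a)) - 1 \<noteq> (0 :: 'k poly)" by force
    qed
    with x show False by simp
  qed
  then show ?thesis using assms(2) by (metis linorder_neqE)
qed

theorem theorem4p0p1:
  fixes q :: "'n::finite \<Rightarrow> 'k::field_char_0"
  assumes "\<And>i. \<not> algebraic (q i)"
  shows "Dq q = subalgebra hull
    (range mult_oper \<union> (\<Union>i. {q_partial q (-1) i, partial i, q_partial q 1 i}))"
    (is "_ = subalgebra hull ?S")
proof
  have q0: "q i \<noteq> 0" for i
  proof
    assume "q i = 0"
    then show False using assms[of i] by simp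
  qed
  have q1: "q i \<noteq> 1" for i
  proof
    assume "q i = 1"
    then show False using assms[of i] by simp
  qed
  have inj: "q i powi a \<noteq> q i powi b" if "a \<noteq> b" for i a b
    by (rule transcendental_powi_inj[OF assms that])
  have gens: "?S \<subseteq> Dq q"
    using Dq_filt_subset_Dq[OF mult_oper_in_Dq_filt_0] Dq_filt_subset_Dq[OF partial_in_Dq_filt_1]
      Dq_filt_subset_Dq[OF q_partial_in_Dq_filt_1[OF q0]] by auto
  then show "subalgebra hull ?S \<subseteq> Dq q" using subalgebra_Dq[OF q0] by (rule hull_minimal)
  have "Dq q \<subseteq> endos" using subalgebra_Dq[of q, OF q0] by (simp only: subalgebra_def)
  with gens have "?S \<subseteq> endos" by (rule subset_trans)
  then have A: "subalgebra (subalgebra hull ?S)" by (rule subalgebra_hull)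
  have S: "?S \<subseteq> subalgebra hull ?S" by (rule hull_subset)
  have "polyexp_opers q \<subseteq> subalgebra hull ?S"
    by (rule polyexp_opers_subset_subalgebra[OF A _ _ _ _ q1 q0]) (use S in auto)
  then show "Dq q \<subseteq> subalgebra hull ?S"
    using Dq_filt_subset_polyexp_opers[of q, OF q0 inj] by (auto simp: Dq_def)
qed

end
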